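(* Let $\Omega\subseteq\mathbb{R}^2$ be an open, bounded image domain with Lipschitz boundary. Let $\beta_i\ge0$ for $i=1,\dots,4$ and let $\beta_3=\beta_4$. Set ${\bm\beta}=(\sqrt{\beta_1},\sqrt{\beta_2},\sqrt{\beta_3},\sqrt{\beta_4})$. Then the regulariser $R_{\bm\beta}(u)$ is rotationally invariant, i.e., for an orthonormal rotation matrix ${\bm Q}\in\mathbb{R}^{2\times2}$ with $${\bm Q}(\theta)=\begin{pmatrix}\cos(\theta)&-\sin(\theta)\\ \sin(\theta)&\cos(\theta)\end{pmatrix}\quad\text{for }\theta\in[0,2\pi)$$ and for $u\in BV(\Omega)$ it holds that $\check u\in BV(\Omega)$, where $\check u=u\circ{\bm Q}$, i.e. $\check u(x)=u({\bm Q}x)$ for a.e. $x\in\Omega$, and $$R_{\bm\beta}(\check u)=R_{\bm\beta}(u).$$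
   Context: $BV(\Omega)$ is the space of functions $u\in L^1(\Omega)$ whose total variation $\sup\{\int_\Omega u\,\mathrm{div}(\varphi)\,dx:\varphi\in C_c^\infty(\Omega,\mathbb{R}^2),\ \|\varphi\|_\infty\le1\}$ is finite. $\mathcal{M}(\Omega,\mathbb{R}^d)$ is the space of finite $\mathbb{R}^d$-valued Radon measures on $\Omega$ with the dual norm $\|\mu\|_{\mathcal{M}(\Omega,\mathbb{R}^d)}=\sup\{\sum_{i=1}^d\int_\Omega\varphi_i\,d\mu_i:\varphi\in C_0(\Omega,\mathbb{R}^d),\ \|\varphi\|_\infty\le1\}$, where $\|\varphi\|_\infty$ is the supremum of the pointwise Euclidean norm. The norm is set to $+\infty$ for distributions that are not finite Radon measures. $\nabla u$ is the distributional gradient. For $w=(w_1,w_2)\in\mathcal{M}(\Omega,\mathbb{R}^2)$, with derivatives in the sense of distributions, $\mathrm{curl}(w)=\partial_{x_1}w_2-\partial_{x_2}w_1$, $\mathrm{div}(w)=\partial_{x_1}w_1+\partial_{x_2}w_2$, $\mathrm{sh}_1(w)=\partial_{x_2}w_2-\partial_{x_1}w_1$, $\mathrm{sh}_2(w)=\partial_{x_2}w_1+\partial_{x_1}w_2$, and $\nabla_Nw=(\mathrm{curl}(w),\mathrm{div}(w),\mathrm{sh}_1(w),\mathrm{sh}_2(w))^\top$. With $\mathrm{diag}({\bm\beta})$ the $4\times4$ diagonal matrix with diagonal ${\bm\beta}$, the regulariser is $$R_{\bm\beta}(u)=\inf_{w\in\mathcal{M}(\Omega,\mathbb{R}^2)}\|\nabla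 u-w\|_{\mathcal{M}(\Omega,\mathbb{R}^2)}+\|\mathrm{diag}({\bm\beta})\nabla_Nw\|_{\mathcal{M}(\Omega,\mathbb{R}^4)}.$$
   Formalization: Since u(Qx) is defined only where Qx lies in Ω, the rotated function ǔ, its BV membership and its regulariser are taken on the rotated domain {x : Qx ∈ Ω}, which equals Ω when Ω is invariant under Q. *)

theory Defs
  imports "HOL-Analysis.Analysis"
begin

section \<open>Test functions\<close>

text \<open>Test functions on an open set are represented by their extension by zero to the whole plane.\<close>

definition partial :: "2 \<Rightarrow> (real^2 \<Rightarrow> 'b::real_normed_vector) \<Rightarrow> real^2 \<Rightarrow> 'b" where
  "partial j f x = frechet_derivative f (at x) (axis j 1)"

fun Ck :: "nat \<Rightarrow> (real^2 \<Rightarrow> 'b::real_normed_vector) \<Rightarrow> bool" where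
  "Ck 0 f \<longleftrightarrow> continuous_on UNIV f"
| "Ck (Suc k) f \<longleftrightarrow> (\<forall>x. f differentiable (at x)) \<and> (\<forall>j. Ck k (partial j f))"

definition test_funs :: "(real^2) set \<Rightarrow> (real^2 \<Rightarrow> 'b::real_normed_vector) set" where
  "test_funs \<Omega> =
     {\<phi>. (\<forall>k. Ck k \<phi>) \<and> compact (closure {x. \<phi> x \<noteq> 0}) \<and> closure {x. \<phi> x \<noteq> 0} \<subseteq> \<Omega>}"

definition divergence :: "(real^2 \<Rightarrow> real^2) \<Rightarrow> real^2 \<Rightarrow> real" where
  "divergence \<phi> x = (\<Sum>j\<in>UNIV. partial j (\<lambda>y. \<phi> y $ j) x)"


section \<open>Functions of bounded variation\<close>

definition total_variation :: "(real^2) set \<Rightarrow> (real^2 \<Rightarrow> real) \<Rightarrow> ereal" where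
  "total_variation \<Omega> u =
     (SUP \<phi> \<in> {\<phi> \<in> test_funs \<Omega>. \<forall>x\<in>\<Omega>. norm (\<phi> x) \<le> 1}.
        ereal (LINT x|lebesgue_on \<Omega>. u x * divergence \<phi> x))"

definition BV :: "(real^2) set \<Rightarrow> (real^2 \<Rightarrow> real) set" where
  "BV \<Omega> = {u. integrable (lebesgue_on \<Omega>) u \<and> total_variation \<Omega> u < \<infinity>}"


section \<open>Finite vector-valued measures\<close>

text \<open>
  A finite vector-valued measure on the Borel subsets of \<open>\<Omega>\<close> is a countably additive set function;
  its values on other sets are irrelevant. On an open subset of the plane every finite Borel measure
  is a Radon measure, so no regularity condition is imposed.
\<close>

abbreviation borel_on :: "(real^2) set \<Rightarrow> (real^2) measure" where
  "borel_on \<Omega> \<equiv> restrict_space borel \<Omega>"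

definition vector_measures :: "(real^2) set \<Rightarrow> ((real^2) set \<Rightarrow> real^'d) set" where
  "vector_measures \<Omega> =
     {\<mu>. \<forall>A::nat \<Rightarrow> (real^2) set. range A \<subseteq> sets (borel_on \<Omega>) \<longrightarrow> disjoint_family A \<longrightarrow>
          (\<lambda>n. \<mu> (A n)) sums \<mu> (\<Union>n. A n)}"

text \<open>The positive part of the Jordan decomposition of a real-valued (signed) measure.\<close>

definition pos_var :: "(real^2) set \<Rightarrow> ((real^2) set \<Rightarrow> real) \<Rightarrow> (real^2) measure" where
  "pos_var \<Omega> \<nu> =
     measure_of \<Omega> (sets (borel_on \<Omega>))
       (\<lambda>A. SUP B \<in> {B \<in> sets (borel_on \<Omega>). B \<subseteq> A}. ennreal (\<nu> B))"

definition neg_var :: "(real^2) set \<Rightarrow> ((real^2) set \<Rightarrow> real) \<Rightarrow> (real^2) measure" where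
  "neg_var \<Omega> \<nu> = pos_var \<Omega> (\<lambda>A. - \<nu> A)"

definition signed_integral ::
    "(real^2) set \<Rightarrow> ((real^2) set \<Rightarrow> real) \<Rightarrow> (real^2 \<Rightarrow> real) \<Rightarrow> real" where
  "signed_integral \<Omega> \<nu> f = (LINT x|pos_var \<Omega> \<nu>. f x) - (LINT x|neg_var \<Omega> \<nu>. f x)"

definition C0 :: "(real^2) set \<Rightarrow> (real^2 \<Rightarrow> real^'d) set" where
  "C0 \<Omega> = {\<phi>. continuous_on \<Omega> \<phi> \<and>
             (\<forall>\<epsilon>>0. \<exists>K. compact K \<and> K \<subseteq> \<Omega> \<and> (\<forall>x\<in>\<Omega> - K. norm (\<phi> x) < \<epsilon>))}"

definition measure_norm :: "(real^2) set \<Rightarrow> ((real^2) set \<Rightarrow> real^'d) \<Rightarrow> ereal" where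
  "measure_norm \<Omega> \<mu> =
     (SUP \<phi> \<in> {\<phi> \<in> C0 \<Omega>. \<forall>x\<in>\<Omega>. norm (\<phi> x) \<le> 1}.
        ereal (\<Sum>i\<in>UNIV. signed_integral \<Omega> (\<lambda>A. \<mu> A $ i) (\<lambda>x. \<phi> x $ i)))"


section \<open>Distributions\<close>

text \<open>
  Only the values of a distribution on \<open>test_funs \<Omega>\<close> are meaningful. A vector-valued distribution is
  a vector of scalar ones.
\<close>

type_synonym distr = "(real^2 \<Rightarrow> real) \<Rightarrow> real"

definition distr_of_fun :: "(real^2) set \<Rightarrow> (real^2 \<Rightarrow> real) \<Rightarrow> distr" where
  "distr_of_fun \<Omega> u = (\<lambda>\<phi>. LINT x|lebesgue_on \<Omega>. u x * \<phi> x)"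

definition distr_of_measure :: "(real^2) set \<Rightarrow> ((real^2) set \<Rightarrow> real^'d) \<Rightarrow> distr^'d" where
  "distr_of_measure \<Omega> \<mu> = (\<chi> i. signed_integral \<Omega> (\<lambda>A. \<mu> A $ i))"

definition D :: "2 \<Rightarrow> distr \<Rightarrow> distr" where
  "D j T = (\<lambda>\<phi>. - T (partial j \<phi>))"

definition grad :: "distr \<Rightarrow> distr^2" where
  "grad T = (\<chi> j. D j T)"

definition curl :: "distr^2 \<Rightarrow> distr" where
  "curl W = (\<lambda>\<phi>. D 1 (W $ 2) \<phi> - D 2 (W $ 1) \<phi>)"

definition dvg :: "distr^2 \<Rightarrow> distr" where
  "dvg W = (\<lambda>\<phi>. D 1 (W $ 1) \<phi> + D 2 (W $ 2) \<phi>)"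

definition sh1 :: "distr^2 \<Rightarrow> distr" where
  "sh1 W = (\<lambda>\<phi>. D 2 (W $ 2) \<phi> - D 1 (W $ 1) \<phi>)"

definition sh2 :: "distr^2 \<Rightarrow> distr" where
  "sh2 W = (\<lambda>\<phi>. D 2 (W $ 1) \<phi> + D 1 (W $ 2) \<phi>)"

definition nabla_N :: "distr^2 \<Rightarrow> distr^4" where
  "nabla_N W = (\<chi> i. if i = 1 then curl W else if i = 2 then dvg W else if i = 3 then sh1 W else sh2 W)"

definition diag :: "real^'n \<Rightarrow> real^'n^'n" where
  "diag b = (\<chi> i j. if i = j then b $ i else 0)"

definition mat_distr :: "real^'n^'m \<Rightarrow> distr^'n \<Rightarrow> distr^'m" where
  "mat_distr A T = (\<chi> i. (\<lambda>\<phi>. \<Sum>j\<in>UNIV. A $ i $ j * (T $ j) \<phi>))"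

definition minus_distr :: "distr^'d \<Rightarrow> distr^'d \<Rightarrow> distr^'d" where
  "minus_distr S T = (\<chi> i. (\<lambda>\<phi>. (S $ i) \<phi> - (T $ i) \<phi>))"

definition represents :: "(real^2) set \<Rightarrow> ((real^2) set \<Rightarrow> real^'d) \<Rightarrow> distr^'d \<Rightarrow> bool" where
  "represents \<Omega> \<mu> T \<longleftrightarrow> (\<forall>i. \<forall>\<phi>\<in>test_funs \<Omega>. (T $ i) \<phi> = (distr_of_measure \<Omega> \<mu> $ i) \<phi>)"

text \<open>
  For open \<open>\<Omega>\<close>, a representing measure is unique (on Borel sets) if it exists. Hence the following
  infimum is the norm of that measure, and it is \<open>\<infinity>\<close> (the infimum of the empty set) for a
  distribution that is not a finite Radon measure.
\<close>

definition distr_norm :: "(real^2) set \<Rightarrow> distr^'d \<Rightarrow> ereal" where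
  "distr_norm \<Omega> T = (INF \<mu> \<in> {\<mu> \<in> vector_measures \<Omega>. represents \<Omega> \<mu> T}. measure_norm \<Omega> \<mu>)"


section \<open>The regulariser\<close>

definition R :: "(real^2) set \<Rightarrow> real^4 \<Rightarrow> (real^2 \<Rightarrow> real) \<Rightarrow> ereal" where
  "R \<Omega> b u =
     (INF w \<in> vector_measures \<Omega>.
        distr_norm \<Omega> (minus_distr (grad (distr_of_fun \<Omega> u)) (distr_of_measure \<Omega> w)) +
        distr_norm \<Omega> (mat_distr (diag b) (nabla_N (distr_of_measure \<Omega> w))))"


section \<open>Domains and rotations\<close>

text \<open>
  Near each boundary point, after a rigid change of coordinates, the set is the part above the graph
  of a Lipschitz function.
\<close>

definition lipschitz_boundary :: "(real^2) set \<Rightarrow> bool" where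
  "lipschitz_boundary \<Omega> \<longleftrightarrow>
     (\<forall>p\<in>frontier \<Omega>. \<exists>(A::real^2 \<Rightarrow> real^2) (\<gamma>::real \<Rightarrow> real) L r.
        orthogonal_transformation A \<and> lipschitz_on L UNIV \<gamma> \<and> r > 0 \<and>
        (\<forall>x\<in>ball p r. x \<in> \<Omega> \<longleftrightarrow> \<gamma> (A x $ 1) < A x $ 2))"

definition Q :: "real \<Rightarrow> real^2^2" where
  "Q \<theta> = vector [vector [cos \<theta>, - sin \<theta>], vector [sin \<theta>, cos \<theta>]]"

text \<open>
  The natural domain of \<open>u \<circ> Q \<theta>\<close> when \<open>u\<close> is defined on \<open>\<Omega>\<close>; it is \<open>\<Omega>\<close> itself exactly when \<open>\<Omega>\<close> is
  invariant under the rotation.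
\<close>

definition rotated_domain :: "real \<Rightarrow> (real^2) set \<Rightarrow> (real^2) set" where
  "rotated_domain \<theta> \<Omega> = {x. Q \<theta> *v x \<in> \<Omega>}"

end

theory Submission
  imports Defs
begin

text \<open>
  Let \<open>V\<close> be the preimage of \<open>\<Omega>\<close> under the rotation \<open>U = Q \<theta>\<close>. Every object on \<open>\<Omega>\<close> has a counterpart
  on \<open>V\<close>: a test function \<open>\<psi>\<close> becomes \<open>\<psi> \<circ> U\<close>, and a vector measure \<open>w\<close> becomes
  \<open>A \<mapsto> P w(U A)\<close> with an orthogonal matrix \<open>P\<close>. Since \<open>U\<close> and \<open>P\<close> are isometries, this does
  not increase the dual norm of a measure (\<open>measure_norm_pull_measure_le\<close>), and hence not the norm
  of a distribution either (\<open>distr_norm_pull_le\<close>).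

  Given a competitor \<open>w\<close> for \<open>u\<close>, take \<open>P = transpose U\<close>. By the chain rule the gradient of the
  rotated function transforms in the same way, so the difference of gradient and competitor does
  (\<open>grad_pull\<close>). The matrix of derivatives of \<open>w\<close> is conjugated by \<open>U\<close>: its trace (divergence)
  and antisymmetric part (curl) are invariant, and its trace-free symmetric part, described by the two
  shears, is rotated by \<open>2 \<theta>\<close>. Hence the natural operator of \<open>w\<close> is multiplied by an orthogonal
  \<open>4 \<times> 4\<close> matrix that mixes only the two shears, and as these carry the same weight the matrix commutes
  with the weights (\<open>nabla_N_pull\<close>). So the regulariser does not increase under rotation
  (\<open>R_matrix_preimage_le\<close>), and applying this to the inverse rotation gives equality. Membership
  in \<open>BV\<close> is the same argument for the total variation, where the divergence of a test field is
  invariant (\<open>total_variation_rotated_le\<close>).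

  The measure-theoretic work lies in the integral against a signed measure, which is defined through
  the Jordan decomposition: its linearity in the measure and its change of variables are obtained from
  a formula that avoids the decomposition (\<open>simple_sum_tendsto_signed_integral\<close>), and the
  decomposition itself from a proof of the Hahn decomposition theorem for real-valued countably
  additive functions.
\<close>

section \<open>Signed measures and their Hahn and Jordan decompositions\<close>

definition signed_measure :: "'a measure \<Rightarrow> ('a set \<Rightarrow> real) \<Rightarrow> bool" where
  "signed_measure M \<nu> \<longleftrightarrow>
     (\<forall>A::nat \<Rightarrow> 'a set. range A \<subseteq> sets M \<longrightarrow> disjoint_family A \<longrightarrow>
        (\<lambda>n. \<nu> (A n)) sums \<nu> (\<Union>n. A n))"

lemma signed_measureD:
  fixes A :: "nat \<Rightarrow> 'a set"
  assumes "signed_measure M \<nu>" "\<And>n. A n \<in> sets M" "disjoint_family A"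
  shows "(\<lambda>n. \<nu> (A n)) sums \<nu> (\<Union>n. A n)"
  using assms unfolding signed_measure_def by blast

lemma signed_measure_empty:
  assumes "signed_measure M \<nu>" shows "\<nu> {} = 0"
proof -
  have "(\<lambda>n::nat. \<nu> {}) sums \<nu> {}"
    using signed_measureD[OF assms, of "\<lambda>_. {}"] by (simp add: disjoint_family_on_def)
  then have "(\<lambda>n::nat. \<nu> {}) \<longlonglongrightarrow> 0"
    using summable_LIMSEQ_zero sums_summable by blast
  then show ?thesis
    by (simp add: LIMSEQ_const_iff)
qed

lemma signed_measure_Un:
  assumes "signed_measure M \<nu>" "A \<in> sets M" "B \<in> sets M" "A \<inter> B = {}"
  shows "\<nu> (A \<union> B) = \<nu> A + \<nu> B"
proof -
  have "(\<lambda>n. \<nu> (binaryset A B n)) sums \<nu> (\<Union>n. binaryset A B n)"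
    using assms by (intro signed_measureD) (auto simp: binaryset_def disjoint_family_on_def)
  moreover have "(\<lambda>n. \<nu> (binaryset A B n)) sums (\<nu> A + \<nu> B)"
    by (intro binaryset_sums signed_measure_empty[OF assms(1)])
  ultimately show ?thesis
    by (simp add: UN_binaryset_eq sums_unique2)
qed

lemma signed_measure_Diff:
  assumes "signed_measure M \<nu>" "A \<in> sets M" "B \<in> sets M" "B \<subseteq> A"
  shows "\<nu> (A - B) = \<nu> A - \<nu> B"
proof -
  have "\<nu> ((A - B) \<union> B) = \<nu> (A - B) + \<nu> B"
    by (rule signed_measure_Un[OF assms(1)]) (use assms in auto)
  moreover have "(A - B) \<union> B = A" using assms(4) by auto
  ultimately show ?thesis by simp
qed

lemma signed_measure_scale:
  "signed_measure M \<nu> \<Longrightarrow> signed_measure M (\<lambda>A. c * \<nu> A)"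
  unfolding signed_measure_def by (auto intro: sums_mult)

lemma signed_measure_sum:
  "(\<And>i. i \<in> I \<Longrightarrow> signed_measure M (\<nu> i)) \<Longrightarrow> signed_measure M (\<lambda>A. \<Sum>i\<in>I. \<nu> i A)"
  unfolding signed_measure_def by (auto intro: sums_sum)

definition positive_set :: "'a measure \<Rightarrow> ('a set \<Rightarrow> real) \<Rightarrow> 'a set \<Rightarrow> bool" where
  "positive_set M \<nu> P \<longleftrightarrow> P \<in> sets M \<and> (\<forall>B\<in>sets M. B \<subseteq> P \<longrightarrow> 0 \<le> \<nu> B)"

text \<open>
  The infimum of \<open>\<nu>\<close> over the subsets of \<open>A\<close> might still be \<open>-\<infinity>\<close>. Truncating at \<open>1\<close> makes the
  supremum of \<open>- \<nu>\<close> finite, and some subset exceeds half of a positive finite supremum.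
\<close>
lemma nearly_most_negative_subset:
  assumes "signed_measure M \<nu>" "A \<in> sets M"
  shows "\<exists>B. B \<in> sets M \<and> B \<subseteq> A \<and> \<nu> B \<le> 0 \<and>
           (\<forall>C\<in>sets M. C \<subseteq> A \<longrightarrow> min 1 (- \<nu> C) \<le> 2 * (- \<nu> B))"
proof -
  define T where "T = (\<lambda>C. min 1 (- \<nu> C)) ` {C \<in> sets M. C \<subseteq> A}"
  have bdd: "bdd_above T"
    unfolding T_def by (rule bdd_aboveI[of _ 1]) auto
  have "min 1 (- \<nu> {}) \<in> T"
    unfolding T_def by (rule imageI) auto
  then have "0 \<in> T"
    by (simp add: signed_measure_empty[OF assms(1)])
  then have nonneg: "0 \<le> Sup T" and ne: "T \<noteq> {}"
    using bdd cSup_upper by auto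
  have upper: "min 1 (- \<nu> C) \<le> Sup T" if "C \<in> sets M" "C \<subseteq> A" for C
    using that bdd unfolding T_def by (intro cSup_upper) auto
  show ?thesis
  proof (cases "Sup T = 0")
    case True
    then show ?thesis
      using upper signed_measure_empty[OF assms(1)] by (intro exI[of _ "{}"]) simp
  next
    case False
    then have "Sup T / 2 < Sup T" using nonneg by simp
    then obtain t where "t \<in> T" "Sup T / 2 < t"
      using less_cSup_iff[OF ne bdd] by blast
    then obtain B where B: "B \<in> sets M" "B \<subseteq> A" "Sup T / 2 < min 1 (- \<nu> B)"
      unfolding T_def by blast
    then have "\<nu> B \<le> 0" using nonneg by auto
    moreover have "min 1 (- \<nu> C) \<le> 2 * (- \<nu> B)" if "C \<in> sets M" "C \<subseteq> A" for C
      using upper[OF that] B(3) by auto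
    ultimately show ?thesis using B by blast
  qed
qed

text \<open>
  Remove greedily from \<open>A\<close> a nearly most negative subset, again and again. The removed sets are
  disjoint, so their values form a convergent series and tend to \<open>0\<close>; hence what survives all
  removals has no subset of negative measure. Removing sets of nonpositive measure does not lower
  the measure.
\<close>
lemma positive_subset_exists:
  assumes \<nu>: "signed_measure M \<nu>" and A: "A \<in> sets M"
  shows "\<exists>P. positive_set M \<nu> P \<and> P \<subseteq> A \<and> \<nu> A \<le> \<nu> P"
proof -
  \<comment> \<open>\<open>good A B\<close>: the set \<open>B\<close> may be removed from \<open>A\<close>; \<open>X n\<close> is what is left of \<open>A\<close> after \<open>n\<close> removals.\<close>
  define good where "good A B \<longleftrightarrow> B \<in> sets M \<and> B \<subseteq> A \<and> \<nu> B \<le> 0 \<and>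
           (\<forall>C\<in>sets M. C \<subseteq> A \<longrightarrow> min 1 (- \<nu> C) \<le> 2 * (- \<nu> B))" for A B
  define pick where "pick A = (SOME B. good A B)" for A
  have pick: "good A (pick A)" if "A \<in> sets M" for A
    unfolding pick_def
    by (rule someI_ex, unfold good_def, rule nearly_most_negative_subset[OF \<nu> that])
  define X where "X n = ((\<lambda>A. A - pick A) ^^ n) A" for n
  define B where "B n = pick (X n)" for n
  have X_Suc: "X (Suc n) = X n - B n" for n
    by (simp add: X_def B_def)
  have X: "X n \<in> sets M" for n
  proof (induction n)
    case 0 then show ?case by (simp add: X_def A)
  next
    case (Suc n)
    then show ?case using pick[OF Suc] by (auto simp: X_Suc B_def good_def)
  qed
  have B: "good (X n) (B n)" for n
    unfolding B_def by (rule pick[OF X])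
  have X_eq: "X n = A - (\<Union>k<n. B k)" for n
  proof (induction n)
    case 0 then show ?case by (simp add: X_def)
  next
    case (Suc n) then show ?case by (auto simp: X_Suc lessThan_Suc)
  qed
  have Bsets: "B n \<in> sets M" and Bneg: "\<nu> (B n) \<le> 0" and Bsub: "B n \<subseteq> X n" for n
    using B[of n] by (auto simp: good_def)
  have disj: "disjoint_family B"
    unfolding disjoint_family_on_def
  proof (intro ballI impI)
    fix m n :: nat assume "m \<noteq> n"
    then show "B m \<inter> B n = {}"
      by (cases m n rule: linorder_cases) (use Bsub X_eq in \<open>blast+\<close>)
  qed
  have sums: "(\<lambda>n. \<nu> (B n)) sums \<nu> (\<Union>n. B n)"
    by (rule signed_measureD[OF \<nu> Bsets disj])
  define P where "P = A - (\<Union>n. B n)"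
  have P: "P \<in> sets M" "P \<subseteq> A" using A Bsets by (auto simp: P_def)
  have "(\<Union>n. B n) \<subseteq> A" using Bsub X_eq by blast
  then have "\<nu> P = \<nu> A - \<nu> (\<Union>n. B n)"
    unfolding P_def using Bsets A by (intro signed_measure_Diff[OF \<nu>]) auto
  moreover have "\<nu> (\<Union>n. B n) \<le> 0"
    using sums Bneg sums_le[OF _ sums sums_zero] by auto
  ultimately have "\<nu> A \<le> \<nu> P" by simp
  moreover have "0 \<le> \<nu> C" if C: "C \<in> sets M" "C \<subseteq> P" for C
  proof -
    have "(\<lambda>n. 2 * (- \<nu> (B n))) \<longlonglongrightarrow> 2 * (- 0)"
      using sums by (intro tendsto_intros summable_LIMSEQ_zero) (rule sums_summable)
    moreover have "min 1 (- \<nu> C) \<le> 2 * (- \<nu> (B n))" for n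
    proof -
      have "C \<subseteq> X n" using C(2) by (auto simp: P_def X_eq)
      then show ?thesis using B[of n] C(1) by (auto simp: good_def)
    qed
    ultimately have "min 1 (- \<nu> C) \<le> 2 * (- 0)"
      by (intro LIMSEQ_le_const) auto
    then show ?thesis by auto
  qed
  ultimately show ?thesis using P by (auto simp: positive_set_def)
qed

lemma positive_set_mono:
  assumes "signed_measure M \<nu>" "positive_set M \<nu> P" "A \<in> sets M" "A \<subseteq> P"
  shows "\<nu> A \<le> \<nu> P"
proof -
  have "0 \<le> \<nu> (P - A)" using assms by (auto simp: positive_set_def)
  then show ?thesis
    using signed_measure_Diff[OF assms(1), of P A] assms by (auto simp: positive_set_def)
qed

lemma positive_set_UN:
  fixes P :: "nat \<Rightarrow> 'a set"
  assumes \<nu>: "signed_measure M \<nu>" and P: "\<And>n. positive_set M \<nu> (P n)"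
  shows "positive_set M \<nu> (\<Union>n. P n)"
proof -
  have sets: "P n \<in> sets M" for n using P by (auto simp: positive_set_def)
  moreover have "0 \<le> \<nu> B" if B: "B \<in> sets M" "B \<subseteq> (\<Union>n. P n)" for B
  proof -
    have sub: "B \<inter> disjointed P n \<subseteq> P n" for n by (auto dest: subsetD[OF disjointed_subset])
    have meas: "B \<inter> disjointed P n \<in> sets M" for n
      using sets.range_disjointed_sets[of P M] sets B(1) by blast
    have "disjoint_family (\<lambda>n. B \<inter> disjointed P n)"
      using disjoint_family_disjointed[of P] by (auto simp: disjoint_family_on_def)
    then have "(\<lambda>n. \<nu> (B \<inter> disjointed P n)) sums \<nu> (\<Union>n. B \<inter> disjointed P n)"
      by (intro signed_measureD[OF \<nu>] meas)
    also have "(\<Union>n. B \<inter> disjointed P n) = B"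
      using B(2) UN_disjointed_eq[of P] by blast
    finally have "(\<lambda>n. \<nu> (B \<inter> disjointed P n)) sums \<nu> B" .
    moreover have "0 \<le> \<nu> (B \<inter> disjointed P n)" for n
      using P[of n, unfolded positive_set_def] meas[of n] sub[of n] by blast
    ultimately show ?thesis
      by (rule sums_le[OF _ sums_zero, rotated])
  qed
  ultimately show ?thesis by (auto simp: positive_set_def)
qed

text \<open>
  A countable union of positive sets is positive, so the supremum of \<open>\<nu>\<close> over the positive sets is
  attained by some \<open>U\<close>, and is therefore finite because \<open>\<nu>\<close> is real-valued. If a set disjoint from
  \<open>U\<close> had positive measure, it would contain a positive set of positive measure, and adding that to
  \<open>U\<close> would exceed the supremum.
\<close>
theorem Hahn_decomposition:
  assumes \<nu>: "signed_measure M \<nu>"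
  obtains P where "positive_set M \<nu> P" "\<And>B. B \<in> sets M \<Longrightarrow> B \<inter> P = {} \<Longrightarrow> \<nu> B \<le> 0"
proof -
  define T where "T = (\<lambda>P. ereal (\<nu> P)) ` {P. positive_set M \<nu> P}"
  have "positive_set M \<nu> {}"
    by (simp add: positive_set_def signed_measure_empty[OF \<nu>])
  then have "T \<noteq> {}" by (auto simp: T_def)
  then obtain f :: "nat \<Rightarrow> ereal" where f: "range f \<subseteq> T" "Sup T = (SUP n. f n)"
    using Sup_countable_SUP by metis
  then have "\<forall>n. \<exists>P. positive_set M \<nu> P \<and> f n = ereal (\<nu> P)"
    unfolding T_def by fast
  then obtain P where P: "\<And>n. positive_set M \<nu> (P n)" "\<And>n. f n = ereal (\<nu> (P n))"
    by metis
  define U where "U = (\<Union>n. P n)"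
  have U: "positive_set M \<nu> U"
    unfolding U_def by (rule positive_set_UN[OF \<nu> P(1)])
  have "f n \<le> ereal (\<nu> U)" for n
    unfolding P(2) using positive_set_mono[OF \<nu> U, of "P n"] P(1)[of n]
    by (auto simp: positive_set_def U_def)
  then have sup: "Sup T \<le> ereal (\<nu> U)"
    unfolding f(2) by (intro SUP_least) auto
  have "\<nu> B \<le> 0" if B: "B \<in> sets M" "B \<inter> U = {}" for B
  proof -
    obtain E where E: "positive_set M \<nu> E" "E \<subseteq> B" "\<nu> B \<le> \<nu> E"
      using positive_subset_exists[OF \<nu> B(1)] by blast
    have "positive_set M \<nu> (\<Union>n::nat. if n = 0 then U else E)"
      by (rule positive_set_UN[OF \<nu>]) (use U E in auto)
    also have "(\<Union>n::nat. if n = 0 then U else E) = U \<union> E"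
      by (auto split: if_splits)
    finally have "positive_set M \<nu> (U \<union> E)" .
    then have "ereal (\<nu> (U \<union> E)) \<le> Sup T"
      unfolding T_def by (intro Sup_upper) auto
    moreover have "\<nu> (U \<union> E) = \<nu> U + \<nu> E"
      using U E B by (intro signed_measure_Un[OF \<nu>]) (auto simp: positive_set_def)
    ultimately have "ereal (\<nu> U + \<nu> E) \<le> Sup T" by simp
    from order_trans[OF this sup] have "\<nu> E \<le> 0" by simp
    then show ?thesis using E(3) by simp
  qed
  then show thesis using that U by blast
qed

lemma sets_pos_var: "sets (pos_var \<Omega> \<nu>) = sets (borel_on \<Omega>)"
  and space_pos_var: "space (pos_var \<Omega> \<nu>) = \<Omega>"
proof -
  have sp: "space (borel_on \<Omega>) = \<Omega>"
    by (simp add: space_restrict_space)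
  have "sets (borel_on \<Omega>) \<subseteq> Pow \<Omega>"
    using sets.space_closed[of "borel_on \<Omega>"] unfolding sp .
  moreover have "sigma_sets \<Omega> (sets (borel_on \<Omega>)) = sets (borel_on \<Omega>)"
    using sets.sigma_sets_eq[of "borel_on \<Omega>"] unfolding sp .
  moreover note sets_measure_of[of "sets (borel_on \<Omega>)" \<Omega>] space_measure_of[of "sets (borel_on \<Omega>)" \<Omega>]
  ultimately show "sets (pos_var \<Omega> \<nu>) = sets (borel_on \<Omega>)" "space (pos_var \<Omega> \<nu>) = \<Omega>"
    unfolding pos_var_def by (simp_all only:)
qed

lemma sets_neg_var: "sets (neg_var \<Omega> \<nu>) = sets (borel_on \<Omega>)"
  and space_neg_var: "space (neg_var \<Omega> \<nu>) = \<Omega>"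
  by (simp_all add: neg_var_def sets_pos_var space_pos_var)

text \<open>
  On a Hahn decomposition the supremum that defines the positive part is attained at \<open>A \<inter> P\<close>. This
  turns it into a countably additive function, so that \<^const>\<open>pos_var\<close>, which \<^const>\<open>measure_of\<close> would
  otherwise replace by the zero measure, has the intended values.
\<close>
lemma emeasure_pos_var:
  assumes \<nu>: "signed_measure (borel_on \<Omega>) \<nu>"
    and P: "positive_set (borel_on \<Omega>) \<nu> P"
    and N: "\<And>B. B \<in> sets (borel_on \<Omega>) \<Longrightarrow> B \<inter> P = {} \<Longrightarrow> \<nu> B \<le> 0"
    and A: "A \<in> sets (borel_on \<Omega>)"
  shows "emeasure (pos_var \<Omega> \<nu>) A = ennreal (\<nu> (A \<inter> P))"
proof -
  let ?p = "\<lambda>A. SUP B \<in> {B \<in> sets (borel_on \<Omega>). B \<subseteq> A}. ennreal (\<nu> B)"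
  have Pm: "P \<in> sets (borel_on \<Omega>)" using P by (simp add: positive_set_def)
  have p: "?p A = ennreal (\<nu> (A \<inter> P))" if A: "A \<in> sets (borel_on \<Omega>)" for A
  proof (rule antisym)
    show "?p A \<le> ennreal (\<nu> (A \<inter> P))"
    proof (rule SUP_least, safe)
      fix B assume B: "B \<in> sets (borel_on \<Omega>)" "B \<subseteq> A"
      have "\<nu> ((B \<inter> P) \<union> (B - P)) = \<nu> (B \<inter> P) + \<nu> (B - P)"
        using B Pm by (intro signed_measure_Un[OF \<nu>]) auto
      moreover have "(B \<inter> P) \<union> (B - P) = B" by auto
      moreover have "\<nu> (B - P) \<le> 0" using B Pm by (intro N) auto
      moreover have "\<nu> (B \<inter> P) \<le> \<nu> (A \<inter> P)"
        using P A B Pm by (intro positive_set_mono[OF \<nu>]) (auto simp: positive_set_def)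
      ultimately show "ennreal (\<nu> B) \<le> ennreal (\<nu> (A \<inter> P))"
        by (intro ennreal_leI) simp
    qed
    show "ennreal (\<nu> (A \<inter> P)) \<le> ?p A"
      using A Pm by (intro SUP_upper) auto
  qed
  have nonneg: "0 \<le> \<nu> (A \<inter> P)" if "A \<in> sets (borel_on \<Omega>)" for A
    using P that Pm by (auto simp: positive_set_def)
  have "countably_additive (sets (borel_on \<Omega>)) ?p"
    unfolding countably_additive_def
  proof (intro allI impI)
    fix A :: "nat \<Rightarrow> _" assume A: "range A \<subseteq> sets (borel_on \<Omega>)" "disjoint_family A"
      "\<Union> (range A) \<in> sets (borel_on \<Omega>)"
    have "(\<lambda>n. \<nu> (A n \<inter> P)) sums \<nu> (\<Union>n. A n \<inter> P)"
      using A Pm by (intro signed_measureD[OF \<nu>]) (auto simp: disjoint_family_on_def)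
    also have "(\<Union>n. A n \<inter> P) = \<Union> (range A) \<inter> P" by auto
    finally have "(\<lambda>n. ennreal (\<nu> (A n \<inter> P))) sums ennreal (\<nu> (\<Union> (range A) \<inter> P))"
      using A nonneg by (subst sums_ennreal) auto
    then show "(\<Sum>i. ?p (A i)) = ?p (\<Union> (range A))"
      using A p by (subst p) (auto simp: p range_subsetD sums_iff)
  qed
  moreover have "positive (sets (borel_on \<Omega>)) ?p"
    by (simp add: positive_def p signed_measure_empty[OF \<nu>])
  ultimately have "emeasure (pos_var \<Omega> \<nu>) A = ?p A"
    using A sets.space_closed[of "borel_on \<Omega>"]
    by (intro emeasure_measure_of[OF pos_var_def]) (simp_all add: sets_pos_var space_restrict_space)
  then show ?thesis using p[OF A] by simp
qed

lemma Jordan_decomposition: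
  assumes \<nu>: "signed_measure (borel_on \<Omega>) \<nu>"
  shows "finite_measure (pos_var \<Omega> \<nu>)" "finite_measure (neg_var \<Omega> \<nu>)"
    and "A \<in> sets (borel_on \<Omega>) \<Longrightarrow> \<nu> A = measure (pos_var \<Omega> \<nu>) A - measure (neg_var \<Omega> \<nu>) A"
proof -
  let ?S = "sets (borel_on \<Omega>)"
  obtain P where P: "positive_set (borel_on \<Omega>) \<nu> P"
    and N: "\<And>B. B \<in> ?S \<Longrightarrow> B \<inter> P = {} \<Longrightarrow> \<nu> B \<le> 0"
    using Hahn_decomposition[OF \<nu>] by metis
  have Pm: "P \<in> ?S" using P by (simp add: positive_set_def)
  have \<Omega>: "\<Omega> \<in> ?S" using sets.top[of "borel_on \<Omega>"] by (simp add: space_restrict_space)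
  have \<nu>': "signed_measure (borel_on \<Omega>) (\<lambda>A. - \<nu> A)"
    using signed_measure_scale[OF \<nu>, of "-1"] by simp
  have sub: "B \<subseteq> \<Omega>" if "B \<in> ?S" for B
    using sets.sets_into_space[OF that] by (simp add: space_restrict_space)
  have pos: "emeasure (pos_var \<Omega> \<nu>) A = ennreal (\<nu> (A \<inter> P))" if "A \<in> ?S" for A
    by (rule emeasure_pos_var[OF \<nu> P N that])
  have neg: "emeasure (neg_var \<Omega> \<nu>) A = ennreal (- \<nu> (A \<inter> (\<Omega> - P)))" if "A \<in> ?S" for A
    unfolding neg_var_def
  proof (rule emeasure_pos_var[OF \<nu>' _ _ that])
    show "positive_set (borel_on \<Omega>) (\<lambda>A. - \<nu> A) (\<Omega> - P)"
      using N Pm \<Omega> by (auto simp: positive_set_def intro!: N)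
    show "- \<nu> B \<le> 0" if "B \<in> ?S" "B \<inter> (\<Omega> - P) = {}" for B
    proof -
      have "B \<subseteq> P" using that(2) sub[OF that(1)] by blast
      then show ?thesis using P that(1) by (simp add: positive_set_def)
    qed
  qed
  show "finite_measure (pos_var \<Omega> \<nu>)" "finite_measure (neg_var \<Omega> \<nu>)"
    by (rule finite_measureI, simp only: space_pos_var space_neg_var pos[OF \<Omega>] neg[OF \<Omega>], simp)+
  assume A: "A \<in> ?S"
  have "0 \<le> \<nu> (A \<inter> P)" using P A Pm by (auto simp: positive_set_def)
  moreover have "\<nu> (A \<inter> (\<Omega> - P)) \<le> 0" using A Pm \<Omega> by (intro N) auto
  moreover have "\<nu> ((A \<inter> P) \<union> (A \<inter> (\<Omega> - P))) = \<nu> (A \<inter> P) + \<nu> (A \<inter> (\<Omega> - P))"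
    using A Pm \<Omega> by (intro signed_measure_Un[OF \<nu>]) auto
  moreover have "(A \<inter> P) \<union> (A \<inter> (\<Omega> - P)) = A" using sub[OF A] by auto
  ultimately show "\<nu> A = measure (pos_var \<Omega> \<nu>) A - measure (neg_var \<Omega> \<nu>) A"
    by (simp add: measure_def pos[OF A] neg[OF A])
qed

section \<open>Integration against a signed measure\<close>

definition bounded_borel :: "(real^2) set \<Rightarrow> (real^2 \<Rightarrow> real) \<Rightarrow> bool" where
  "bounded_borel \<Omega> f \<longleftrightarrow> f \<in> borel_measurable (borel_on \<Omega>) \<and> (\<exists>C. \<forall>x\<in>\<Omega>. \<bar>f x\<bar> \<le> C)"

lemma space_borel_on [simp]: "space (borel_on \<Omega>) = \<Omega>"
  by (simp add: space_restrict_space)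

lemma bounded_borel_integrable:
  assumes "finite_measure M" "sets M = sets (borel_on \<Omega>)" "bounded_borel \<Omega> f"
  shows "integrable M f"
proof -
  interpret finite_measure M by fact
  have sp: "space M = \<Omega>"
    using sets_eq_imp_space_eq[OF assms(2)] by simp
  obtain C where C: "\<And>x. x \<in> \<Omega> \<Longrightarrow> \<bar>f x\<bar> \<le> C" and m: "f \<in> borel_measurable (borel_on \<Omega>)"
    using assms(3) by (auto simp: bounded_borel_def)
  have "f \<in> borel_measurable M"
    using m assms(2) by (simp cong: measurable_cong_sets)
  then show ?thesis
    by (intro integrable_const_bound[of _ C]) (auto simp: C sp intro!: AE_I2)
qed

text \<open>
  Uniformly bounded pointwise approximation by simple functions. Boundedness is what dominated
  convergence needs on finite measures; no measure enters, so one sequence serves all of them.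
\<close>
definition simple_approx :: "(real^2) set \<Rightarrow> (real^2 \<Rightarrow> real) \<Rightarrow> (nat \<Rightarrow> real^2 \<Rightarrow> real) \<Rightarrow> bool" where
  "simple_approx \<Omega> f s \<longleftrightarrow>
     (\<forall>n. simple_function (borel_on \<Omega>) (s n)) \<and> (\<forall>x\<in>\<Omega>. (\<lambda>n. s n x) \<longlonglongrightarrow> f x) \<and>
     (\<exists>C. \<forall>n. \<forall>x\<in>\<Omega>. \<bar>s n x\<bar> \<le> C)"

lemma simple_approx_exists:
  assumes "bounded_borel \<Omega> f"
  obtains s where "simple_approx \<Omega> f s"
proof -
  obtain C where C: "\<And>x. x \<in> \<Omega> \<Longrightarrow> \<bar>f x\<bar> \<le> C" and m: "f \<in> borel_measurable (borel_on \<Omega>)"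
    using assms by (auto simp: bounded_borel_def)
  obtain s where s: "\<forall>i. simple_function (borel_on \<Omega>) (s i)"
    "\<forall>x\<in>\<Omega>. (\<lambda>i. s i x) \<longlonglongrightarrow> f x" "\<forall>i. \<forall>x\<in>\<Omega>. \<bar>s i x\<bar> \<le> 2 * \<bar>f x\<bar>"
    using borel_measurable_implies_sequence_metric[OF m, of 0] by auto
  have "\<bar>s i x\<bar> \<le> 2 * C" if "x \<in> \<Omega>" for i x
    using bspec[OF spec[OF s(3), of i] that] C[OF that] by linarith
  then have "simple_approx \<Omega> f s"
    unfolding simple_approx_def using s by blast
  then show thesis by (rule that)
qed

definition simple_sum :: "(real^2) set \<Rightarrow> ((real^2) set \<Rightarrow> real) \<Rightarrow> (real^2 \<Rightarrow> real) \<Rightarrow> real" where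
  "simple_sum \<Omega> \<nu> s = (\<Sum>y\<in>s ` \<Omega>. \<nu> {x\<in>\<Omega>. s x = y} * y)"

text \<open>
  For simple functions the integral is a finite sum of values of the measure; the limit is taken
  by dominated convergence.
\<close>
lemma simple_sum_tendsto_integral:
  assumes M: "finite_measure M" "sets M = sets (borel_on \<Omega>)"
    and s: "simple_approx \<Omega> f s" and f: "bounded_borel \<Omega> f"
  shows "(\<lambda>n. simple_sum \<Omega> (measure M) (s n)) \<longlonglongrightarrow> (LINT x|M. f x)"
proof -
  interpret finite_measure M by fact
  have sp: "space M = \<Omega>"
    using sets_eq_imp_space_eq[OF M(2)] by simp
  obtain C where C: "\<And>n x. x \<in> \<Omega> \<Longrightarrow> \<bar>s n x\<bar> \<le> C"
    using s unfolding simple_approx_def by blast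
  have simple: "\<And>n. simple_function (borel_on \<Omega>) (s n)"
    and lim: "\<And>x. x \<in> \<Omega> \<Longrightarrow> (\<lambda>n. s n x) \<longlonglongrightarrow> f x"
    using s by (auto simp: simple_approx_def)
  have simple': "simple_function M (s n)" for n
    using simple[of n] M(2) sp by (simp add: simple_function_def)
  have "(\<lambda>n. LINT x|M. s n x) \<longlonglongrightarrow> (LINT x|M. f x)"
    using C lim borel_measurable_simple_function[OF simple']
    by (intro integral_dominated_convergence[where w="\<lambda>_. C"]
          borel_measurable_integrable[OF bounded_borel_integrable[OF M f]])
       (auto simp: sp)
  moreover have "(LINT x|M. s n x) = simple_sum \<Omega> (measure M) (s n)" for n
  proof -
    have "Bochner_Integration.simple_bochner_integrable M (s n)"
      by (simp add: simple_bochner_integrable.simps simple' emeasure_eq_measure)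
    from simple_bochner_integrable_eq_integral[OF this, symmetric] show ?thesis
      by (simp add: simple_bochner_integral_def simple_sum_def sp)
  qed
  ultimately show ?thesis by simp
qed

text \<open>
  The Jordan decomposition of a sum of signed measures is in general not the sum of the Jordan
  decompositions. The sums on the left do not mention the decomposition at all and depend on \<open>\<nu>\<close> linearly, which makes linearity in \<open>\<nu>\<close> and invariance under changes
  of variables immediate.
\<close>
lemma simple_sum_tendsto_signed_integral:
  assumes \<nu>: "signed_measure (borel_on \<Omega>) \<nu>"
    and s: "simple_approx \<Omega> f s" and f: "bounded_borel \<Omega> f"
  shows "(\<lambda>n. simple_sum \<Omega> \<nu> (s n)) \<longlonglongrightarrow> signed_integral \<Omega> \<nu> f"
proof -
  note J = Jordan_decomposition[OF \<nu>]
  have "(\<lambda>n. simple_sum \<Omega> (measure (pos_var \<Omega> \<nu>)) (s n) - simple_sum \<Omega> (measure (neg_var \<Omega> \<nu>)) (s n))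
      \<longlonglongrightarrow> signed_integral \<Omega> \<nu> f"
    unfolding signed_integral_def
    by (intro tendsto_diff simple_sum_tendsto_integral J s f sets_pos_var sets_neg_var)
  moreover have "simple_sum \<Omega> (measure (pos_var \<Omega> \<nu>)) (s n) - simple_sum \<Omega> (measure (neg_var \<Omega> \<nu>)) (s n)
      = simple_sum \<Omega> \<nu> (s n)" for n
  proof -
    have "simple_function (borel_on \<Omega>) (s n)"
      using s by (simp add: simple_approx_def)
    then have "{x\<in>\<Omega>. s n x = y} \<in> sets (borel_on \<Omega>)" for y
      using simple_functionD(2)[of "borel_on \<Omega>" "s n" "{y}"]
      by (simp add: vimage_def Int_def conj_commute)
    from J(3)[OF this] show ?thesis
      by (simp add: simple_sum_def sum_subtractf[symmetric] left_diff_distrib)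
  qed
  ultimately show ?thesis by simp
qed

lemma signed_integral_sum_measure:
  assumes \<nu>: "\<And>i. i \<in> I \<Longrightarrow> signed_measure (borel_on \<Omega>) (\<nu> i)" and f: "bounded_borel \<Omega> f"
  shows "signed_integral \<Omega> (\<lambda>A. \<Sum>i\<in>I. c i * \<nu> i A) f = (\<Sum>i\<in>I. c i * signed_integral \<Omega> (\<nu> i) f)"
proof -
  obtain s where s: "simple_approx \<Omega> f s" by (rule simple_approx_exists[OF f])
  have "signed_measure (borel_on \<Omega>) (\<lambda>A. \<Sum>i\<in>I. c i * \<nu> i A)"
    by (intro signed_measure_sum signed_measure_scale \<nu>)
  from simple_sum_tendsto_signed_integral[OF this s f]
  have "(\<lambda>n. \<Sum>i\<in>I. c i * simple_sum \<Omega> (\<nu> i) (s n))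
      \<longlonglongrightarrow> signed_integral \<Omega> (\<lambda>A. \<Sum>i\<in>I. c i * \<nu> i A) f"
    by (simp add: simple_sum_def sum_distrib_left sum_distrib_right ac_simps
          sum.swap[of _ I])
  moreover have "(\<lambda>n. \<Sum>i\<in>I. c i * simple_sum \<Omega> (\<nu> i) (s n))
      \<longlonglongrightarrow> (\<Sum>i\<in>I. c i * signed_integral \<Omega> (\<nu> i) f)"
    by (intro tendsto_sum tendsto_mult tendsto_const simple_sum_tendsto_signed_integral \<nu> s f)
  ultimately show ?thesis by (rule LIMSEQ_unique)
qed

lemma signed_integral_sum_fun:
  assumes \<nu>: "signed_measure (borel_on \<Omega>) \<nu>" and f: "\<And>i. i \<in> I \<Longrightarrow> bounded_borel \<Omega> (f i)"
  shows "signed_integral \<Omega> \<nu> (\<lambda>x. \<Sum>i\<in>I. c i * f i x) = (\<Sum>i\<in>I. c i * signed_integral \<Omega> \<nu> (f i))"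
proof -
  have int: "integrable (pos_var \<Omega> \<nu>) (f i)" "integrable (neg_var \<Omega> \<nu>) (f i)" if "i \<in> I" for i
    using bounded_borel_integrable[OF Jordan_decomposition(1)[OF \<nu>] sets_pos_var f[OF that]]
      bounded_borel_integrable[OF Jordan_decomposition(2)[OF \<nu>] sets_neg_var f[OF that]] .
  show ?thesis
    by (simp add: signed_integral_def int right_diff_distrib sum_subtractf)
qed

section \<open>Transport of measures by orthogonal matrices\<close>

declare transpose_matrix_vector [simp del]

text \<open>
  For \<open>U = Q \<theta>\<close> this is \<^const>\<open>rotated_domain\<close>. The inverse of an orthogonal \<open>U\<close> is written as
  \<^term>\<open>transpose U\<close> throughout, so that a function \<open>\<phi>\<close> on the preimage corresponds to
  \<open>\<lambda>x. \<phi> (transpose U *v x)\<close> on \<open>\<Omega>\<close>.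
\<close>
definition matrix_preimage :: "real^2^2 \<Rightarrow> (real^2) set \<Rightarrow> (real^2) set" where
  "matrix_preimage U \<Omega> = {x. U *v x \<in> \<Omega>}"

lemma orthogonal_matrix_cancel [simp]:
  fixes U :: "real^'n^'n"
  assumes "orthogonal_matrix U"
  shows "U *v (transpose U *v x) = x" "transpose U *v (U *v x) = x"
  using assms by (simp_all add: matrix_vector_mul_assoc orthogonal_matrix_def)

lemma norm_orthogonal_matrix_mult [simp]:
  fixes U :: "real^'n^'n"
  assumes "orthogonal_matrix U"
  shows "norm (U *v x) = norm x"
  using assms orthogonal_transformation_norm orthogonal_transformation_matrix by fastforce

lemma image_matrix_preimage:
  assumes "orthogonal_matrix U"
  shows "(*v) U ` matrix_preimage U \<Omega> = \<Omega>"
proof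
  show "\<Omega> \<subseteq> (*v) U ` matrix_preimage U \<Omega>"
  proof
    fix x assume "x \<in> \<Omega>"
    then show "x \<in> (*v) U ` matrix_preimage U \<Omega>"
      using assms by (intro image_eqI[where x="transpose U *v x"]) (simp_all add: matrix_preimage_def)
  qed
qed (auto simp: matrix_preimage_def)

lemma matrix_preimage_transpose:
  "orthogonal_matrix U \<Longrightarrow> matrix_preimage (transpose U) (matrix_preimage U \<Omega>) = \<Omega>"
  by (simp add: matrix_preimage_def)

lemma open_matrix_preimage: "open \<Omega> \<Longrightarrow> open (matrix_preimage U \<Omega>)"
  unfolding matrix_preimage_def
  using open_vimage[of \<Omega> "(*v) U"] by (simp add: vimage_def matrix_vector_mult_linear_continuous_at continuous_at_imp_continuous_on)

lemma measurable_matrix_preimage: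
  "(*v) U \<in> measurable (borel_on (matrix_preimage U \<Omega>)) (borel_on \<Omega>)"
proof (rule measurable_restrict_space3)
  show "(*v) U \<in> borel \<rightarrow>\<^sub>M borel"
    by (intro borel_measurable_continuous_onI) (simp add: matrix_vector_mult_linear_continuous_on)
qed (auto simp: matrix_preimage_def)

lemma measurable_transpose:
  assumes "orthogonal_matrix U"
  shows "(*v) (transpose U) \<in> measurable (borel_on \<Omega>) (borel_on (matrix_preimage U \<Omega>))"
  using measurable_matrix_preimage[of "transpose U" "matrix_preimage U \<Omega>"]
  by (simp add: matrix_preimage_transpose[OF assms])

lemma image_matrix_measurable:
  assumes U: "orthogonal_matrix U" and A: "A \<in> sets (borel_on (matrix_preimage U \<Omega>))"
  shows "(*v) U ` A \<in> sets (borel_on \<Omega>)"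
proof -
  have "A \<subseteq> matrix_preimage U \<Omega>"
    using sets.sets_into_space[OF A] by simp
  then have "(*v) U ` A = (*v) (transpose U) -` A \<inter> space (borel_on \<Omega>)"
    using U by (auto simp: matrix_preimage_def intro!: image_eqI[where x="transpose U *v _"])
  then show ?thesis
    using measurable_sets[OF measurable_transpose[OF U] A] by simp
qed

lemma bounded_borel_transpose:
  assumes U: "orthogonal_matrix U" and f: "bounded_borel (matrix_preimage U \<Omega>) f"
  shows "bounded_borel \<Omega> (\<lambda>x. f (transpose U *v x))"
proof -
  have "f \<in> borel_measurable (borel_on (matrix_preimage U \<Omega>))"
    using f by (simp add: bounded_borel_def)
  from measurable_compose[OF measurable_transpose[OF U] this] show ?thesis
    using f U by (force simp: bounded_borel_def matrix_preimage_def)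
qed

lemma signed_measure_image:
  assumes U: "orthogonal_matrix U" and \<nu>: "signed_measure (borel_on \<Omega>) \<nu>"
  shows "signed_measure (borel_on (matrix_preimage U \<Omega>)) (\<lambda>A. \<nu> ((*v) U ` A))"
  unfolding signed_measure_def
proof (intro allI impI)
  fix A :: "nat \<Rightarrow> (real^2) set"
  assume A: "range A \<subseteq> sets (borel_on (matrix_preimage U \<Omega>))" "disjoint_family A"
  have "inj ((*v) U)"
    using U by (metis injI orthogonal_matrix_cancel(2))
  then have "disjoint_family (\<lambda>n. (*v) U ` A n)"
    using A(2) by (simp add: disjoint_family_on_def image_Int[symmetric])
  then have "(\<lambda>n. \<nu> ((*v) U ` A n)) sums \<nu> (\<Union>n. (*v) U ` A n)"
    using A(1) by (intro signed_measureD[OF \<nu>] image_matrix_measurable[OF U]) auto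
  then show "(\<lambda>n. \<nu> ((*v) U ` A n)) sums \<nu> ((*v) U ` (\<Union>n. A n))"
    by (simp add: image_UN)
qed

lemma signed_integral_image:
  assumes U: "orthogonal_matrix U" and \<nu>: "signed_measure (borel_on \<Omega>) \<nu>"
    and f: "bounded_borel (matrix_preimage U \<Omega>) f"
  shows "signed_integral (matrix_preimage U \<Omega>) (\<lambda>A. \<nu> ((*v) U ` A)) f
       = signed_integral \<Omega> \<nu> (\<lambda>x. f (transpose U *v x))"
proof -
  let ?V = "matrix_preimage U \<Omega>"
  obtain s where s: "simple_approx ?V f s" by (rule simple_approx_exists[OF f])
  define t where "t n x = s n (transpose U *v x)" for n x
  have tr: "transpose U *v x \<in> ?V \<longleftrightarrow> x \<in> \<Omega>" for x
    using U by (simp add: matrix_preimage_def)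
  have "simple_function (borel_on \<Omega>) (t n)" for n
  proof -
    have simple: "finite (s n ` ?V)" "s n \<in> borel_on ?V \<rightarrow>\<^sub>M count_space UNIV"
      using s by (simp_all add: simple_approx_def simple_function_eq_measurable)
    have "t n ` \<Omega> \<subseteq> s n ` ?V"
      unfolding t_def using tr by blast
    then show ?thesis
      using finite_subset[OF _ simple(1)] measurable_compose[OF measurable_transpose[OF U] simple(2)]
      by (simp add: simple_function_eq_measurable t_def[abs_def])
  qed
  then have t: "simple_approx \<Omega> (\<lambda>x. f (transpose U *v x)) t"
    using s tr unfolding simple_approx_def t_def by blast
  have "simple_sum ?V (\<lambda>A. \<nu> ((*v) U ` A)) (s n) = simple_sum \<Omega> \<nu> (t n)" for n
  proof -
    have "(*v) U ` {x \<in> ?V. s n x = y} = {x \<in> \<Omega>. t n x = y}" for y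
      using U by (auto simp: t_def matrix_preimage_def intro!: image_eqI[where x="transpose U *v _"])
    moreover have "s n ` ?V = t n ` ((*v) U ` ?V)"
      using U by (auto simp: image_image t_def)
    ultimately show ?thesis
      by (simp add: simple_sum_def image_matrix_preimage[OF U])
  qed
  then have "(\<lambda>n. simple_sum \<Omega> \<nu> (t n)) \<longlonglongrightarrow> signed_integral ?V (\<lambda>A. \<nu> ((*v) U ` A)) f"
    using simple_sum_tendsto_signed_integral[OF signed_measure_image[OF U \<nu>] s f] by simp
  moreover have "(\<lambda>n. simple_sum \<Omega> \<nu> (t n)) \<longlonglongrightarrow> signed_integral \<Omega> \<nu> (\<lambda>x. f (transpose U *v x))"
    by (rule simple_sum_tendsto_signed_integral[OF \<nu> t bounded_borel_transpose[OF U f]])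
  ultimately show ?thesis by (rule LIMSEQ_unique)
qed

text \<open>
  A vector measure lives on points and on vectors: \<open>U\<close> moves the points and \<open>P\<close> acts on the values.
  For the gradient-like measures of the regulariser \<open>P\<close> is the transpose of \<open>U\<close>, for the measures
  that represent \<^const>\<open>nabla_N\<close> it is a different orthogonal matrix.
\<close>
definition pull_measure ::
    "real^2^2 \<Rightarrow> real^'d^'d \<Rightarrow> ((real^2) set \<Rightarrow> real^'d) \<Rightarrow> (real^2) set \<Rightarrow> real^'d" where
  "pull_measure U P \<mu> A = P *v \<mu> ((*v) U ` A)"

lemma vector_measures_component:
  "\<mu> \<in> vector_measures \<Omega> \<longleftrightarrow> (\<forall>i. signed_measure (borel_on \<Omega>) (\<lambda>A. \<mu> A $ i))"
proof -
  have "f sums a \<longleftrightarrow> (\<forall>i. (\<lambda>n. f n $ i) sums (a $ i))" for f :: "nat \<Rightarrow> real^'d" and a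
    unfolding sums_def by (auto simp: tendsto_vec_nth intro: vec_tendstoI simp flip: sum_component)
  then show ?thesis
    by (auto simp: vector_measures_def signed_measure_def)
qed

lemma pull_measure_component:
  "pull_measure U P \<mu> A $ i = (\<Sum>j\<in>UNIV. P $ i $ j * \<mu> ((*v) U ` A) $ j)"
  by (simp add: pull_measure_def matrix_vector_mult_def)

lemma pull_measure_vector_measures:
  assumes "orthogonal_matrix U" "\<mu> \<in> vector_measures \<Omega>"
  shows "pull_measure U P \<mu> \<in> vector_measures (matrix_preimage U \<Omega>)"
  using assms unfolding vector_measures_component pull_measure_component
  by (auto intro!: signed_measure_sum signed_measure_scale signed_measure_image)

lemma signed_integral_pull_measure:
  assumes U: "orthogonal_matrix U" and \<mu>: "\<mu> \<in> vector_measures \<Omega>"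
    and f: "bounded_borel (matrix_preimage U \<Omega>) f"
  shows "signed_integral (matrix_preimage U \<Omega>) (\<lambda>A. pull_measure U P \<mu> A $ i) f
       = (\<Sum>j\<in>UNIV. P $ i $ j * signed_integral \<Omega> (\<lambda>A. \<mu> A $ j) (\<lambda>x. f (transpose U *v x)))"
proof -
  have \<mu>': "signed_measure (borel_on \<Omega>) (\<lambda>A. \<mu> A $ j)" for j
    using \<mu> by (simp add: vector_measures_component)
  show ?thesis
    unfolding pull_measure_component
    by (subst signed_integral_sum_measure[OF signed_measure_image[OF U \<mu>'] f])
       (simp add: signed_integral_image[OF U \<mu>' f])
qed

lemma C0_transform:
  fixes \<phi> :: "real^2 \<Rightarrow> real^'d"
  assumes U: "orthogonal_matrix U" and P: "orthogonal_matrix P"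
    and \<phi>: "\<phi> \<in> C0 (matrix_preimage U \<Omega>)"
  shows "(\<lambda>x. P *v \<phi> (transpose U *v x)) \<in> C0 \<Omega>"
  unfolding C0_def
proof (intro CollectI conjI allI impI)
  let ?V = "matrix_preimage U \<Omega>"
  have sub: "(*v) (transpose U) ` \<Omega> \<subseteq> ?V"
    using U by (auto simp: matrix_preimage_def)
  have \<phi>U: "continuous_on \<Omega> (\<lambda>x. \<phi> (transpose U *v x))"
    using \<phi> by (intro continuous_on_compose2[OF _ matrix_vector_mult_linear_continuous_on sub]) (simp add: C0_def)
  show "continuous_on \<Omega> (\<lambda>x. P *v \<phi> (transpose U *v x))"
    by (rule continuous_on_compose2[OF matrix_vector_mult_linear_continuous_on[of UNIV] \<phi>U]) simp
  fix e :: real assume "0 < e"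
  then have "\<exists>K. compact K \<and> K \<subseteq> ?V \<and> (\<forall>x\<in>?V - K. norm (\<phi> x) < e)"
    using \<phi> unfolding C0_def by simp
  then obtain K where K: "compact K" "K \<subseteq> ?V" "\<forall>x\<in>?V - K. norm (\<phi> x) < e"
    by auto
  show "\<exists>K. compact K \<and> K \<subseteq> \<Omega> \<and> (\<forall>x\<in>\<Omega> - K. norm (P *v \<phi> (transpose U *v x)) < e)"
  proof (intro exI conjI ballI)
    show "compact ((*v) U ` K)"
      by (intro compact_continuous_image K matrix_vector_mult_linear_continuous_on)
    show "(*v) U ` K \<subseteq> \<Omega>"
      using K(2) by (auto simp: matrix_preimage_def)
    fix x assume x: "x \<in> \<Omega> - (*v) U ` K"
    have "transpose U *v x \<notin> K"
    proof
      assume "transpose U *v x \<in> K"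
      then have "U *v (transpose U *v x) \<in> (*v) U ` K" by (rule imageI)
      then show False using x U by simp
    qed
    then have "transpose U *v x \<in> ?V - K"
      using x sub by blast
    then show "norm (P *v \<phi> (transpose U *v x)) < e"
      using P K(3) by simp
  qed
qed

lemma C0_bounded_borel:
  assumes "\<phi> \<in> C0 \<Omega>" "\<forall>x\<in>\<Omega>. norm (\<phi> x) \<le> 1"
  shows "bounded_borel \<Omega> (\<lambda>x. \<phi> x $ i)"
  unfolding bounded_borel_def
proof
  show "(\<lambda>x. \<phi> x $ i) \<in> borel_measurable (borel_on \<Omega>)"
    using assms(1) by (intro borel_measurable_continuous_on_restrict continuous_on_component) (simp add: C0_def)
  show "\<exists>C. \<forall>x\<in>\<Omega>. \<bar>\<phi> x $ i\<bar> \<le> C"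
    using assms(2) component_le_norm_cart order_trans by blast
qed

text \<open>
  Pairing the transformed measure with \<open>\<phi>\<close> is the same as pairing \<open>\<mu>\<close> with the transformed test
  function \<open>\<psi>\<close>, which is again admissible because both \<open>U\<close> and \<open>P\<close> preserve the Euclidean norm.
\<close>
lemma measure_norm_pull_measure_le:
  fixes \<mu> :: "(real^2) set \<Rightarrow> real^'d"
  assumes U: "orthogonal_matrix U" and P: "orthogonal_matrix P" and \<mu>: "\<mu> \<in> vector_measures \<Omega>"
  shows "measure_norm (matrix_preimage U \<Omega>) (pull_measure U P \<mu>) \<le> measure_norm \<Omega> \<mu>"
  unfolding measure_norm_def[of "matrix_preimage U \<Omega>"]
proof (rule SUP_least, safe)
  let ?V = "matrix_preimage U \<Omega>"
  fix \<phi> :: "real^2 \<Rightarrow> real^'d" assume \<phi>: "\<phi> \<in> C0 ?V" "\<forall>x\<in>?V. norm (\<phi> x) \<le> 1"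
  define \<psi> where "\<psi> x = transpose P *v \<phi> (transpose U *v x)" for x
  have \<phi>b: "bounded_borel ?V (\<lambda>x. \<phi> x $ i)" for i
    by (rule C0_bounded_borel[OF \<phi>])
  have \<mu>': "signed_measure (borel_on \<Omega>) (\<lambda>A. \<mu> A $ j)" for j
    using \<mu> by (simp add: vector_measures_component)
  have \<psi>: "\<psi> \<in> C0 \<Omega>" "\<forall>x\<in>\<Omega>. norm (\<psi> x) \<le> 1"
    unfolding \<psi>_def using C0_transform[OF U _ \<phi>(1), of "transpose P"] \<phi>(2) U P
    by (auto simp: matrix_preimage_def)
  have "(\<Sum>i\<in>UNIV. signed_integral ?V (\<lambda>A. pull_measure U P \<mu> A $ i) (\<lambda>x. \<phi> x $ i))
      = (\<Sum>i\<in>UNIV. \<Sum>j\<in>UNIV. P $ i $ j *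
           signed_integral \<Omega> (\<lambda>A. \<mu> A $ j) (\<lambda>x. \<phi> (transpose U *v x) $ i))"
    by (simp add: signed_integral_pull_measure[OF U \<mu> \<phi>b])
  also have "\<dots> = (\<Sum>j\<in>UNIV. \<Sum>i\<in>UNIV. P $ i $ j *
           signed_integral \<Omega> (\<lambda>A. \<mu> A $ j) (\<lambda>x. \<phi> (transpose U *v x) $ i))"
    by (rule sum.swap)
  also have "\<dots> = (\<Sum>j\<in>UNIV. signed_integral \<Omega> (\<lambda>A. \<mu> A $ j)
           (\<lambda>x. \<Sum>i\<in>UNIV. P $ i $ j * \<phi> (transpose U *v x) $ i))"
    by (simp add: signed_integral_sum_fun[OF \<mu>' bounded_borel_transpose[OF U \<phi>b]])
  also have "\<dots> = (\<Sum>j\<in>UNIV. signed_integral \<Omega> (\<lambda>A. \<mu> A $ j) (\<lambda>x. \<psi> x $ j))"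
    by (simp add: \<psi>_def matrix_vector_mult_def transpose_def)
  finally show "ereal (\<Sum>i\<in>UNIV. signed_integral ?V (\<lambda>A. pull_measure U P \<mu> A $ i) (\<lambda>x. \<phi> x $ i))
      \<le> measure_norm \<Omega> \<mu>"
    unfolding measure_norm_def using \<psi> by (intro SUP_upper2[of \<psi>]) auto
qed

section \<open>Test functions under linear changes of variables\<close>

lemma partial_eqI:
  "(f has_derivative f') (at x) \<Longrightarrow> partial j f x = f' (axis j 1)"
  unfolding partial_def by (drule frechet_derivative_at) simp

lemma has_derivative_frechet:
  "f differentiable at x \<Longrightarrow> (f has_derivative frechet_derivative f (at x)) (at x)"
  by (simp add: frechet_derivative_works)

lemma has_derivative_matrix_vector_mult: "((\<lambda>x. U *v x) has_derivative (\<lambda>x. U *v x)) (at x)"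
  for U :: "real^'n^'m"
  by (rule bounded_linear_imp_has_derivative[OF matrix_vector_mul_bounded_linear])

text \<open>
  The chain rule: the direction \<open>axis j 1\<close> is sent to the \<open>j\<close>-th column of \<open>U\<close>.
\<close>
lemma partial_compose_matrix:
  fixes f :: "real^2 \<Rightarrow> 'b::real_normed_vector"
  assumes f: "f differentiable at (U *v x)"
  shows "partial j (\<lambda>x. f (U *v x)) x = (\<Sum>i\<in>UNIV. (U $ i $ j) *\<^sub>R partial i f (U *v x))"
proof -
  let ?f' = "frechet_derivative f (at (U *v x))"
  have lin: "linear ?f'"
    using linear_frechet_derivative[OF f] .
  have "((\<lambda>x. f (U *v x)) has_derivative (\<lambda>h. ?f' (U *v h))) (at x)"
    using has_derivative_compose[OF has_derivative_matrix_vector_mult has_derivative_frechet[OF f]] .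
  then have "partial j (\<lambda>x. f (U *v x)) x = ?f' (U *v axis j 1)"
    by (rule partial_eqI)
  also have "U *v axis j 1 = (\<Sum>i\<in>UNIV. (U $ i $ j) *\<^sub>R axis i 1)"
    using basis_expansion[of "column j U", symmetric]
    by (simp add: matrix_vector_mult_basis column_def scalar_mult_eq_scaleR)
  also have "?f' \<dots> = (\<Sum>i\<in>UNIV. (U $ i $ j) *\<^sub>R ?f' (axis i 1))"
    by (simp add: linear_sum[OF lin] linear_scale[OF lin])
  finally show ?thesis
    by (simp add: partial_def)
qed

lemma partial_bounded_linear:
  assumes h: "bounded_linear h" and f: "f differentiable at x"
  shows "partial j (\<lambda>x. h (f x)) x = h (partial j f x)"
  using partial_eqI[OF bounded_linear.has_derivative[OF h has_derivative_frechet[OF f]], of j]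
  by (simp add: partial_def)

lemma partial_sum:
  assumes "\<And>i. i \<in> I \<Longrightarrow> f i differentiable at x"
  shows "partial j (\<lambda>x. \<Sum>i\<in>I. c i *\<^sub>R f i x) x = (\<Sum>i\<in>I. c i *\<^sub>R partial j (f i) x)"
proof -
  have "((\<lambda>x. \<Sum>i\<in>I. c i *\<^sub>R f i x) has_derivative
         (\<lambda>h. \<Sum>i\<in>I. c i *\<^sub>R frechet_derivative (f i) (at x) h)) (at x)"
    using assms by (intro has_derivative_sum has_derivative_scaleR_right has_derivative_frechet)
  from partial_eqI[OF this] show ?thesis by (simp add: partial_def)
qed

lemma Ck_sum:
  assumes "\<And>i. i \<in> I \<Longrightarrow> Ck k (f i)"
  shows "Ck k (\<lambda>x. \<Sum>i\<in>I. c i *\<^sub>R f i x)"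
  using assms
proof (induction k arbitrary: f)
  case 0
  then show ?case by (auto intro!: continuous_intros)
next
  case (Suc k)
  have "partial j (\<lambda>x. \<Sum>i\<in>I. c i *\<^sub>R f i x) = (\<lambda>x. \<Sum>i\<in>I. c i *\<^sub>R partial j (f i) x)" for j
    using Suc.prems by (intro ext partial_sum) simp
  moreover have "Ck k (\<lambda>x. \<Sum>i\<in>I. c i *\<^sub>R partial j (f i) x)" for j
    using Suc.prems by (intro Suc.IH) simp
  moreover have "(\<lambda>x. \<Sum>i\<in>I. c i *\<^sub>R f i x) differentiable at x" for x
  proof (cases "finite I")
    case True
    then show ?thesis using Suc.prems by (intro differentiable_sum differentiable_scaleR) auto
  qed simp
  ultimately show ?case by simp
qed

lemma Ck_bounded_linear:
  assumes h: "bounded_linear h" and "Ck k f"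
  shows "Ck k (\<lambda>x. h (f x))"
  using assms(2)
proof (induction k arbitrary: f)
  case 0
  then show ?case by (simp add: bounded_linear.continuous_on[OF h])
next
  case (Suc k)
  have "partial j (\<lambda>x. h (f x)) = (\<lambda>x. h (partial j f x))" for j
    using Suc.prems by (intro ext partial_bounded_linear[OF h]) simp
  moreover have "Ck k (\<lambda>x. h (partial j f x))" for j
    using Suc.prems by (intro Suc.IH) simp
  moreover have "(\<lambda>x. h (f x)) differentiable at x" for x
    using Suc.prems bounded_linear.has_derivative[OF h] by (force simp: differentiable_def)
  ultimately show ?case by simp
qed

lemma Ck_compose_matrix:
  fixes f :: "real^2 \<Rightarrow> 'b::real_normed_vector"
  assumes "Ck k f"
  shows "Ck k (\<lambda>x. f (U *v x))"
  using assms
proof (induction k arbitrary: f)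
  case 0
  then have "continuous_on UNIV f" by simp
  from continuous_on_compose2[OF this matrix_vector_mult_linear_continuous_on[of UNIV]]
  show ?case by simp
next
  case (Suc k)
  have "partial j (\<lambda>x. f (U *v x)) = (\<lambda>x. \<Sum>i\<in>UNIV. (U $ i $ j) *\<^sub>R partial i f (U *v x))" for j
    using Suc.prems by (intro ext partial_compose_matrix) simp
  moreover have "Ck k (\<lambda>x. \<Sum>i\<in>UNIV. (U $ i $ j) *\<^sub>R partial i f (U *v x))" for j
    using Suc.prems by (intro Ck_sum Suc.IH) simp
  moreover have "(\<lambda>x. f (U *v x)) differentiable at x" for x
  proof -
    have "f differentiable at (U *v x)" using Suc.prems by simp
    from has_derivative_compose[OF has_derivative_matrix_vector_mult has_derivative_frechet[OF this]]
    show ?thesis by (rule differentiableI)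
  qed
  ultimately show ?case by simp
qed

lemma test_funsI:
  assumes "\<And>k. Ck k f" "compact K" "K \<subseteq> \<Omega>" "\<And>x. x \<notin> K \<Longrightarrow> f x = 0"
  shows "f \<in> test_funs \<Omega>"
proof -
  have sub: "closure {x. f x \<noteq> 0} \<subseteq> K"
    using assms(2,4) by (intro closure_minimal compact_imp_closed) auto
  moreover have "compact (closure {x. f x \<noteq> 0})"
    using compact_Int_closed[OF assms(2) closed_closure[of "{x. f x \<noteq> 0}"]]
    by (simp add: Int_absorb1[OF sub])
  ultimately show ?thesis
    using assms(1,3) by (auto simp: test_funs_def)
qed

lemma test_funsE:
  assumes "f \<in> test_funs \<Omega>"
  obtains K where "\<And>k. Ck k f" "compact K" "K \<subseteq> \<Omega>" "\<And>x. x \<notin> K \<Longrightarrow> f x = 0"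
proof (rule that)
  show "f x = 0" if "x \<notin> closure {x. f x \<noteq> 0}" for x
    using that closure_subset[of "{x. f x \<noteq> 0}"] by auto
qed (use assms in \<open>auto simp: test_funs_def\<close>)

lemma test_funs_differentiable: "f \<in> test_funs \<Omega> \<Longrightarrow> f differentiable at x"
  using Ck.simps(2)[of 0 f] by (simp add: test_funs_def del: Ck.simps)

lemma test_funs_partial:
  assumes "f \<in> test_funs \<Omega>"
  shows "partial j f \<in> test_funs \<Omega>"
proof -
  obtain K where K: "\<And>k. Ck k f" "compact K" "K \<subseteq> \<Omega>" "\<And>x. x \<notin> K \<Longrightarrow> f x = 0"
    using assms by (rule test_funsE) blast
  show ?thesis
  proof (rule test_funsI[OF _ K(2,3)])
    show "Ck k (partial j f)" for k
      using K(1)[of "Suc k"] by simp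
    fix x assume x: "x \<notin> K"
    have "((\<lambda>_. 0) has_derivative (\<lambda>_. 0)) (at x)" by simp
    then have "(f has_derivative (\<lambda>_. 0)) (at x)"
      by (rule has_derivative_transform_within_open[where s="- K"])
         (use x K in \<open>auto intro: compact_imp_closed open_Compl\<close>)
    then show "partial j f x = 0" by (rule partial_eqI)
  qed
qed

text \<open>
  The function is supported in the image under \<open>U\<close> of the compact support of \<open>f\<close>.
\<close>
lemma test_funs_transform:
  assumes U: "orthogonal_matrix U" and h: "bounded_linear h"
    and f: "f \<in> test_funs (matrix_preimage U \<Omega>)"
  shows "(\<lambda>x. h (f (transpose U *v x))) \<in> test_funs \<Omega>"
proof -
  obtain K where K: "\<And>k. Ck k f" "compact K" "K \<subseteq> matrix_preimage U \<Omega>" "\<And>x. x \<notin> K \<Longrightarrow> f x = 0"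
    using f by (rule test_funsE) blast
  show ?thesis
  proof (rule test_funsI)
    show "Ck k (\<lambda>x. h (f (transpose U *v x)))" for k
      by (intro Ck_bounded_linear[OF h] Ck_compose_matrix K)
    show "compact ((*v) U ` K)"
      by (intro compact_continuous_image K matrix_vector_mult_linear_continuous_on)
    show "(*v) U ` K \<subseteq> \<Omega>"
      using K(3) by (auto simp: matrix_preimage_def)
    fix x assume x: "x \<notin> (*v) U ` K"
    have "transpose U *v x \<notin> K"
    proof
      assume "transpose U *v x \<in> K"
      then have "U *v (transpose U *v x) \<in> (*v) U ` K" by (rule imageI)
      then show False using x U by simp
    qed
    then show "h (f (transpose U *v x)) = 0"
      using K(4) bounded_linear.linear[OF h] by (simp add: linear_0)
  qed
qed

lemmas test_funs_compose = test_funs_transform[OF _ bounded_linear_ident]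

lemma test_funs_continuous_bounded:
  fixes f :: "real^2 \<Rightarrow> real"
  assumes "f \<in> test_funs \<Omega>"
  shows "continuous_on UNIV f" "\<exists>C. \<forall>x. \<bar>f x\<bar> \<le> C"
proof -
  obtain K where K: "\<And>k. Ck k f" "compact K" "K \<subseteq> \<Omega>" "\<And>x. x \<notin> K \<Longrightarrow> f x = 0"
    using assms by (rule test_funsE) blast
  show c: "continuous_on UNIV f"
    using K(1)[of 0] by simp
  have "bounded (f ` K)"
    using K(2) c by (meson compact_continuous_image compact_imp_bounded continuous_on_subset subset_UNIV)
  then obtain C where C: "\<And>x. x \<in> K \<Longrightarrow> \<bar>f x\<bar> \<le> C"
    by (auto simp: bounded_iff)
  have "\<bar>f x\<bar> \<le> max C 0" for x
    using C[of x] K(4)[of x] by (cases "x \<in> K") (simp_all add: le_max_iff_disj)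
  then show "\<exists>C. \<forall>x. \<bar>f x\<bar> \<le> C" by blast
qed

lemma test_funs_bounded_borel:
  assumes "f \<in> test_funs \<Omega>"
  shows "bounded_borel \<Omega>' f"
  unfolding bounded_borel_def
proof
  show "f \<in> borel_measurable (borel_on \<Omega>')"
    using test_funs_continuous_bounded(1)[OF assms]
    by (intro borel_measurable_continuous_on_restrict) (rule continuous_on_subset, auto)
qed (use test_funs_continuous_bounded(2)[OF assms] in auto)

text \<open>
  The chain rule read backwards: a derivative of \<open>\<phi>\<close>, transported to \<open>\<Omega>\<close>, is a combination of the
  derivatives of the transported function. This is the form in which distributional derivatives use
  it.
\<close>
lemma partial_transform:
  fixes \<phi> :: "real^2 \<Rightarrow> 'b::real_normed_vector"
  assumes U: "orthogonal_matrix U" and \<phi>: "\<phi> \<in> test_funs (matrix_preimage U \<Omega>)"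
  shows "partial j \<phi> (transpose U *v x)
       = (\<Sum>l\<in>UNIV. (U $ l $ j) *\<^sub>R partial l (\<lambda>x. \<phi> (transpose U *v x)) x)"
proof -
  let ?\<psi> = "\<lambda>x. \<phi> (transpose U *v x)"
  have "?\<psi> differentiable at (U *v (transpose U *v x))"
    using test_funs_compose[OF U \<phi>] by (rule test_funs_differentiable)
  from partial_compose_matrix[OF this, of j] show ?thesis
    using U by simp
qed

section \<open>Lebesgue integrals and total variation under orthogonal maps\<close>

lemma matrix_image_eq_vimage:
  fixes U :: "real^'n^'n"
  assumes U: "orthogonal_matrix U"
  shows "(*v) U -` A = (*v) (transpose U) ` A"
proof
  show "(*v) U -` A \<subseteq> (*v) (transpose U) ` A"
  proof
    fix x assume "x \<in> (*v) U -` A"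
    then show "x \<in> (*v) (transpose U) ` A"
      using U by (intro image_eqI[where x="U *v x"]) simp_all
  qed
qed (use U in auto)

lemma orthogonal_transformation_transpose:
  "orthogonal_matrix (U::real^'n^'n) \<Longrightarrow> orthogonal_transformation ((*v) (transpose U))"
  by (simp add: orthogonal_transformation_matrix)

text \<open>
  Lebesgue measure is determined by its values on boxes, and an orthogonal map preserves these.
\<close>
lemma distr_lborel_orthogonal:
  fixes U :: "real^'n::{finite,wellorder}^'n::_"
  assumes U: "orthogonal_matrix U"
  shows "distr lborel borel ((*v) U) = lborel"
proof (rule lborel_eqI[symmetric])
  have meas: "(*v) U \<in> borel \<rightarrow>\<^sub>M borel"
    by (intro borel_measurable_continuous_onI) (simp add: matrix_vector_mult_linear_continuous_on)
  fix l u :: "real^'n::_" assume le: "\<And>b. b \<in> Basis \<Longrightarrow> l \<bullet> b \<le> u \<bullet> b"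
  let ?B = "(*v) U -` box l u"
  have "?B \<in> sets borel"
    using measurable_sets[OF meas, of "box l u"] by simp
  moreover have B: "?B \<in> lmeasurable" "measure lebesgue ?B = measure lebesgue (box l u)"
    unfolding matrix_image_eq_vimage[OF U]
    using measurable_orthogonal_image[OF orthogonal_transformation_transpose[OF U] lmeasurable_box]
      measure_orthogonal_image[OF orthogonal_transformation_transpose[OF U] lmeasurable_box] by auto
  ultimately have "emeasure lborel ?B = ennreal (measure lebesgue (box l u))"
    using emeasure_eq_measure2[OF B(1)] by simp
  also have "\<dots> = (\<Prod>b\<in>Basis. (u - l) \<bullet> b)"
    using le by (simp add: measure_lborel_box_eq)
  finally show "emeasure (distr lborel borel ((*v) U)) (box l u) = (\<Prod>b\<in>Basis. (u - l) \<bullet> b)"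
    using meas by (simp add: emeasure_distr)
qed simp

lemma lebesgue_orthogonal:
  fixes U :: "real^'n::{finite,wellorder}^'n::_"
  assumes U: "orthogonal_matrix U"
  shows measurable_lebesgue_orthogonal: "(*v) U \<in> lebesgue \<rightarrow>\<^sub>M lebesgue"
    and distr_lebesgue_orthogonal: "distr lebesgue lebesgue ((*v) U) = lebesgue"
proof -
  have meas: "(*v) U \<in> lborel \<rightarrow>\<^sub>M lborel"
    by (simp, intro borel_measurable_continuous_onI) (simp add: matrix_vector_mult_linear_continuous_on)
  have eq: "distr lebesgue lborel ((*v) U) = lborel"
    using distr_lborel_orthogonal[OF U] meas by (simp add: distr_completion cong: distr_cong)
  have meas': "(*v) U \<in> lebesgue \<rightarrow>\<^sub>M lborel"
    by (rule measurable_completion[OF meas])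
  show "(*v) U \<in> lebesgue \<rightarrow>\<^sub>M lebesgue"
    by (rule completion.measurable_completion2[OF meas']) (simp add: eq)
  show "distr lebesgue lebesgue ((*v) U) = lebesgue"
    using completion.completion_distr_eq[OF meas'] by (simp add: eq)
qed

lemma measurable_lebesgue_on_matrix_preimage:
  assumes "orthogonal_matrix U"
  shows "(*v) U \<in> lebesgue_on (matrix_preimage U \<Omega>) \<rightarrow>\<^sub>M lebesgue_on \<Omega>"
  using measurable_lebesgue_orthogonal[OF assms]
  by (rule measurable_restrict_space3) (auto simp: matrix_preimage_def)

lemma distr_lebesgue_on_matrix_preimage:
  assumes U: "orthogonal_matrix U" and \<Omega>: "\<Omega> \<in> sets lebesgue"
  shows "distr (lebesgue_on (matrix_preimage U \<Omega>)) (lebesgue_on \<Omega>) ((*v) U) = lebesgue_on \<Omega>"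
proof (rule measure_eqI)
  let ?V = "matrix_preimage U \<Omega>"
  have V: "?V \<in> sets lebesgue"
    using measurable_sets[OF measurable_lebesgue_orthogonal[OF U] \<Omega>]
    by (simp add: matrix_preimage_def vimage_def)
  fix A assume "A \<in> sets (distr (lebesgue_on ?V) (lebesgue_on \<Omega>) ((*v) U))"
  then have A: "A \<in> sets (lebesgue_on \<Omega>)" by simp
  then have A': "A \<subseteq> \<Omega>" "A \<in> sets lebesgue"
    using \<Omega> by (auto simp: sets_restrict_space)
  have "emeasure (distr (lebesgue_on ?V) (lebesgue_on \<Omega>) ((*v) U)) A
      = emeasure (lebesgue_on ?V) ((*v) U -` A \<inter> ?V)"
    using emeasure_distr[OF measurable_lebesgue_on_matrix_preimage[OF U] A] by simp
  also have "(*v) U -` A \<inter> ?V = (*v) U -` A"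
    using A' by (auto simp: matrix_preimage_def)
  also have "emeasure (lebesgue_on ?V) ((*v) U -` A) = emeasure lebesgue ((*v) U -` A)"
    using A' V by (intro emeasure_restrict_space) (auto simp: matrix_preimage_def)
  also have "\<dots> = emeasure (distr lebesgue lebesgue ((*v) U)) A"
    using emeasure_distr[OF measurable_lebesgue_orthogonal[OF U] A'(2)] by simp
  also have "\<dots> = emeasure (lebesgue_on \<Omega>) A"
    using A' \<Omega> by (simp add: distr_lebesgue_orthogonal[OF U] emeasure_restrict_space)
  finally show "emeasure (distr (lebesgue_on ?V) (lebesgue_on \<Omega>) ((*v) U)) A = emeasure (lebesgue_on \<Omega>) A" .
qed simp

text \<open>
  The rotated function is given only almost everywhere; completeness of Lebesgue measure is what
  makes it measurable nevertheless.
\<close>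
lemma borel_measurable_lebesgue_on_AE:
  fixes f g :: "'a::euclidean_space \<Rightarrow> real"
  assumes S: "S \<in> sets lebesgue" and f: "f \<in> borel_measurable (lebesgue_on S)"
    and ae: "AE x in lebesgue_on S. g x = f x"
  shows "g \<in> borel_measurable (lebesgue_on S)"
proof (rule measurableI)
  interpret complete_measure "lebesgue_on S"
  proof
    fix A B assume "B \<subseteq> A" "A \<in> null_sets (lebesgue_on S)"
    then have "B \<in> null_sets (lebesgue_on S)"
      using S completion.complete2 by (simp add: null_sets_restrict_space) blast
    then show "B \<in> sets (lebesgue_on S)" by auto
  qed
  fix T :: "real set" assume T: "T \<in> sets borel"
  show "g -` T \<inter> space (lebesgue_on S) \<in> sets (lebesgue_on S)"
  proof (rule in_sets_AE)
    show "f -` T \<inter> space (lebesgue_on S) \<in> sets (lebesgue_on S)"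
      by (rule measurable_sets[OF f T])
    show "AE x in lebesgue_on S. (x \<in> f -` T \<inter> space (lebesgue_on S)) = (x \<in> g -` T \<inter> space (lebesgue_on S))"
      using ae by eventually_elim simp
  qed auto
qed simp

locale rotated_function =
  fixes U :: "real^2^2" and \<Omega> :: "(real^2) set" and u u' :: "real^2 \<Rightarrow> real"
  assumes U: "orthogonal_matrix U" and \<Omega>: "open \<Omega>"
    and u: "integrable (lebesgue_on \<Omega>) u"
    and u': "AE x in lebesgue_on (matrix_preimage U \<Omega>). u' x = u (U *v x)"
begin

abbreviation "V \<equiv> matrix_preimage U \<Omega>"

lemma measurable_rotated: "u' \<in> borel_measurable (lebesgue_on V)"
proof (rule borel_measurable_lebesgue_on_AE[OF _ _ u'])
  show "V \<in> sets lebesgue"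
    using open_matrix_preimage[OF \<Omega>] by auto
  show "(\<lambda>x. u (U *v x)) \<in> borel_measurable (lebesgue_on V)"
    using measurable_compose[OF measurable_lebesgue_on_matrix_preimage[OF U] borel_measurable_integrable[OF u]] .
qed

lemma integrable_rotated: "integrable (lebesgue_on V) u'"
proof -
  have "integrable (distr (lebesgue_on V) (lebesgue_on \<Omega>) ((*v) U)) u"
    using u \<Omega> by (simp add: distr_lebesgue_on_matrix_preimage[OF U])
  then have "integrable (lebesgue_on V) (\<lambda>x. u (U *v x))"
    by (rule integrable_distr[OF measurable_lebesgue_on_matrix_preimage[OF U]])
  moreover have "AE x in lebesgue_on V. u (U *v x) = u' x"
    using u' by eventually_elim simp
  ultimately show ?thesis
    by (rule integrable_cong_AE_imp[OF _ measurable_rotated])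
qed

lemma integral_rotated:
  assumes g: "continuous_on UNIV (g::real^2 \<Rightarrow> real)"
  shows "(LINT x|lebesgue_on V. u' x * g x) = (LINT x|lebesgue_on \<Omega>. u x * g (transpose U *v x))"
proof -
  let ?f = "\<lambda>x. u x * g (transpose U *v x)"
  have cont: "continuous_on UNIV (\<lambda>x. g (transpose U *v x))"
    using continuous_on_compose2[OF g matrix_vector_mult_linear_continuous_on[of UNIV]] by simp
  have leb: "h \<in> borel_measurable (lebesgue_on S)" if "continuous_on UNIV h" for h :: "real^2 \<Rightarrow> real" and S
    using that by (intro measurable_restrict_space1 measurable_completion) (simp add: borel_measurable_continuous_onI)
  have f: "?f \<in> borel_measurable (lebesgue_on \<Omega>)"
    using borel_measurable_integrable[OF u] leb[OF cont] by simp
  have "(LINT x|lebesgue_on V. u' x * g x) = (LINT x|lebesgue_on V. ?f (U *v x))"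
  proof (rule integral_cong_AE)
    show "(\<lambda>x. u' x * g x) \<in> borel_measurable (lebesgue_on V)"
      using measurable_rotated leb[OF g] by simp
    show "(\<lambda>x. ?f (U *v x)) \<in> borel_measurable (lebesgue_on V)"
      using measurable_compose[OF measurable_lebesgue_on_matrix_preimage[OF U] f] .
    show "AE x in lebesgue_on V. u' x * g x = ?f (U *v x)"
      using u' by eventually_elim (use U in simp)
  qed
  also have "\<dots> = (LINT x|distr (lebesgue_on V) (lebesgue_on \<Omega>) ((*v) U). ?f x)"
    by (rule integral_distr[OF measurable_lebesgue_on_matrix_preimage[OF U] f, symmetric])
  finally show ?thesis
    using \<Omega> by (simp add: distr_lebesgue_on_matrix_preimage[OF U])
qed

text \<open>
  To a test field \<open>\<phi>\<close> on the preimage corresponds the field \<open>\<psi>\<close> on \<open>\<Omega>\<close> with values turned by \<open>U\<close>;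
  the divergence, being a trace, is not affected.
\<close>
lemma total_variation_rotated_le: "total_variation V u' \<le> total_variation \<Omega> u"
  unfolding total_variation_def[of V]
proof (rule SUP_least, safe)
  fix \<phi> :: "real^2 \<Rightarrow> real^2" assume \<phi>: "\<phi> \<in> test_funs V" "\<forall>x\<in>V. norm (\<phi> x) \<le> 1"
  define \<psi> where "\<psi> x = U *v \<phi> (transpose U *v x)" for x
  have \<psi>: "\<psi> \<in> test_funs \<Omega>"
    unfolding \<psi>_def by (rule test_funs_transform[OF U matrix_vector_mul_bounded_linear \<phi>(1)])
  have \<psi>1: "\<forall>x\<in>\<Omega>. norm (\<psi> x) \<le> 1"
    using \<phi>(2) U by (simp add: \<psi>_def matrix_preimage_def)
  have comp: "(\<lambda>x. \<phi> x $ j) \<in> test_funs V" for j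
  proof -
    have one: "orthogonal_matrix (mat 1 :: real^2^2)" by (rule orthogonal_matrix_id)
    have "matrix_preimage (mat 1) V = V" by (simp add: matrix_preimage_def)
    then show ?thesis
      using test_funs_transform[OF one bounded_linear_vec_nth[of j], of \<phi> V] \<phi>(1)
      by (simp add: transpose_mat)
  qed
  have div: "divergence \<phi> (transpose U *v x) = divergence \<psi> x" for x
  proof -
    let ?c = "\<lambda>j x. \<phi> (transpose U *v x) $ j"
    have diff: "?c j differentiable at x" for j
      by (rule test_funs_differentiable[OF test_funs_compose[OF U comp]])
    have "divergence \<phi> (transpose U *v x)
        = (\<Sum>j\<in>UNIV. \<Sum>l\<in>UNIV. (U $ l $ j) *\<^sub>R partial l (?c j) x)"
      unfolding divergence_def by (intro sum.cong refl partial_transform[OF U comp])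
    also have "\<dots> = (\<Sum>l\<in>UNIV. \<Sum>j\<in>UNIV. (U $ l $ j) *\<^sub>R partial l (?c j) x)"
      by (rule sum.swap)
    also have "\<dots> = (\<Sum>l\<in>UNIV. partial l (\<lambda>x. \<Sum>j\<in>UNIV. (U $ l $ j) *\<^sub>R ?c j x) x)"
      by (intro sum.cong refl partial_sum[symmetric] diff)
    also have "\<dots> = divergence \<psi> x"
      by (simp add: divergence_def \<psi>_def matrix_vector_mult_def)
    finally show ?thesis .
  qed
  have "continuous_on UNIV (divergence \<phi>)"
    unfolding divergence_def[abs_def]
    by (intro continuous_on_sum test_funs_continuous_bounded(1)[OF test_funs_partial[OF comp]])
  from integral_rotated[OF this]
  have "(LINT x|lebesgue_on V. u' x * divergence \<phi> x) = (LINT x|lebesgue_on \<Omega>. u x * divergence \<psi> x)"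
    by (simp add: div)
  then show "ereal (LINT x|lebesgue_on V. u' x * divergence \<phi> x) \<le> total_variation \<Omega> u"
    unfolding total_variation_def using \<psi> \<psi>1 by (intro SUP_upper2[of \<psi>]) auto
qed

end

section \<open>The regulariser under rotations\<close>

text \<open>
  If \<open>\<mu>\<close> represents \<open>T\<close>, its transform represents \<open>T'\<close>, and the norm does not grow. The
  reverse inequality is the same statement for the inverse of \<open>U\<close>.
\<close>
lemma distr_norm_pull_le:
  fixes T T' :: "distr^'d"
  assumes U: "orthogonal_matrix U" and P: "orthogonal_matrix P"
    and T: "\<And>i \<phi>. \<phi> \<in> test_funs (matrix_preimage U \<Omega>) \<Longrightarrow>
      (T' $ i) \<phi> = (\<Sum>j\<in>UNIV. P $ i $ j * (T $ j) (\<lambda>x. \<phi> (transpose U *v x)))"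
  shows "distr_norm (matrix_preimage U \<Omega>) T' \<le> distr_norm \<Omega> T"
  unfolding distr_norm_def[of \<Omega>]
proof (rule INF_greatest, safe)
  let ?V = "matrix_preimage U \<Omega>"
  fix \<mu> :: "(real^2) set \<Rightarrow> real^'d" assume \<mu>: "\<mu> \<in> vector_measures \<Omega>" "represents \<Omega> \<mu> T"
  have "represents ?V (pull_measure U P \<mu>) T'"
    unfolding represents_def
  proof (intro allI ballI)
    fix i and \<phi> :: "real^2 \<Rightarrow> real" assume \<phi>: "\<phi> \<in> test_funs ?V"
    have "(T $ j) (\<lambda>x. \<phi> (transpose U *v x))
        = signed_integral \<Omega> (\<lambda>A. \<mu> A $ j) (\<lambda>x. \<phi> (transpose U *v x))" for j
      using \<mu>(2) test_funs_compose[OF U \<phi>] by (simp add: represents_def distr_of_measure_def)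
    then show "(T' $ i) \<phi> = (distr_of_measure ?V (pull_measure U P \<mu>) $ i) \<phi>"
      using T[OF \<phi>]
      by (simp add: distr_of_measure_def
          signed_integral_pull_measure[OF U \<mu>(1) test_funs_bounded_borel[OF \<phi>]])
  qed
  then have "distr_norm ?V T' \<le> measure_norm ?V (pull_measure U P \<mu>)"
    unfolding distr_norm_def using pull_measure_vector_measures[OF U \<mu>(1)] by (intro INF_lower) simp
  also have "\<dots> \<le> measure_norm \<Omega> \<mu>"
    by (rule measure_norm_pull_measure_le[OF U P \<mu>(1)])
  finally show "distr_norm ?V T' \<le> measure_norm \<Omega> \<mu>" .
qed

text \<open>
  The type of distributions contains arbitrary functionals. Linearity for the two summands that the
  chain rule produces is all that the transformation of derivatives requires.
\<close>
definition linear_distr :: "(real^2) set \<Rightarrow> distr \<Rightarrow> bool" where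
  "linear_distr \<Omega> T \<longleftrightarrow> (\<forall>(c::2 \<Rightarrow> real) \<psi>. (\<forall>l. \<psi> l \<in> test_funs \<Omega>) \<longrightarrow>
     T (\<lambda>x. \<Sum>l\<in>UNIV. c l * \<psi> l x) = (\<Sum>l\<in>UNIV. c l * T (\<psi> l)))"

lemma linear_distrD:
  fixes \<psi> :: "2 \<Rightarrow> real^2 \<Rightarrow> real"
  assumes "linear_distr \<Omega> T" "\<And>l. \<psi> l \<in> test_funs \<Omega>"
  shows "T (\<lambda>x. \<Sum>l\<in>UNIV. c l * \<psi> l x) = (\<Sum>l\<in>UNIV. c l * T (\<psi> l))"
  using assms by (simp add: linear_distr_def)

lemma linear_distr_of_measure:
  assumes "\<mu> \<in> vector_measures \<Omega>"
  shows "linear_distr \<Omega> (distr_of_measure \<Omega> \<mu> $ i)"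
  using assms
  by (auto simp: linear_distr_def distr_of_measure_def vector_measures_component
      intro!: signed_integral_sum_fun test_funs_bounded_borel)

lemma linear_distr_of_fun:
  assumes u: "integrable (lebesgue_on \<Omega>) u"
  shows "linear_distr \<Omega> (distr_of_fun \<Omega> u)"
  unfolding linear_distr_def
proof (intro allI impI)
  fix c :: "2 \<Rightarrow> real" and \<psi> :: "2 \<Rightarrow> real^2 \<Rightarrow> real" assume \<psi>: "\<forall>l. \<psi> l \<in> test_funs \<Omega>"
  have int: "integrable (lebesgue_on \<Omega>) (\<lambda>x. u x * \<psi> l x)" for l
  proof -
    have \<psi>l: "continuous_on UNIV (\<psi> l)" "\<exists>C. \<forall>x. \<bar>\<psi> l x\<bar> \<le> C"
      using test_funs_continuous_bounded \<psi> by blast+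
    then obtain C where C: "\<And>x. \<bar>\<psi> l x\<bar> \<le> C" by blast
    have "\<psi> l \<in> borel_measurable (lebesgue_on \<Omega>)"
      using \<psi>l(1)
      by (intro measurable_restrict_space1 measurable_completion) (simp add: borel_measurable_continuous_onI)
    then have meas: "(\<lambda>x. u x * \<psi> l x) \<in> borel_measurable (lebesgue_on \<Omega>)"
      using borel_measurable_integrable[OF u] by simp
    have dom: "integrable (lebesgue_on \<Omega>) (\<lambda>x. C * u x)"
      using u by simp
    have le: "norm (u x * \<psi> l x) \<le> norm (C * u x)" for x
    proof -
      have "\<bar>\<psi> l x\<bar> \<le> \<bar>C\<bar>" using C[of x] by simp
      then show ?thesis
        using mult_right_mono[of "\<bar>\<psi> l x\<bar>" "\<bar>C\<bar>" "\<bar>u x\<bar>"] by (simp add: abs_mult mult.commute)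
    qed
    show ?thesis
      by (rule Bochner_Integration.integrable_bound[OF dom meas]) (rule AE_I2[OF le])
  qed
  have "u x * (\<Sum>l\<in>UNIV. c l * \<psi> l x) = (\<Sum>l\<in>UNIV. c l * (u x * \<psi> l x))" for x
    by (simp add: sum_distrib_left ac_simps)
  then show "distr_of_fun \<Omega> u (\<lambda>x. \<Sum>l\<in>UNIV. c l * \<psi> l x) = (\<Sum>l\<in>UNIV. c l * distr_of_fun \<Omega> u (\<psi> l))"
    by (simp add: distr_of_fun_def int)
qed

text \<open>
  The left-hand side is the \<open>j\<close>-th derivative, at \<open>\<phi>\<close>, of the distribution on the preimage that sends
  \<open>\<phi>\<close> to \<open>T (\<lambda>x. \<phi> (transpose U *v x))\<close>.
\<close>
lemma D_compose:
  assumes U: "orthogonal_matrix U" and \<phi>: "\<phi> \<in> test_funs (matrix_preimage U \<Omega>)" and T: "linear_distr \<Omega> T"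
  shows "- T (\<lambda>x. partial j \<phi> (transpose U *v x))
       = (\<Sum>l\<in>UNIV. U $ l $ j * D l T (\<lambda>x. \<phi> (transpose U *v x)))"
proof -
  have "T (\<lambda>x. \<Sum>l\<in>UNIV. U $ l $ j * partial l (\<lambda>x. \<phi> (transpose U *v x)) x)
      = (\<Sum>l\<in>UNIV. U $ l $ j * T (partial l (\<lambda>x. \<phi> (transpose U *v x))))"
    by (rule linear_distrD[OF T]) (rule test_funs_partial[OF test_funs_compose[OF U \<phi>]])
  then show ?thesis
    by (simp add: partial_transform[OF U \<phi>] D_def sum_negf)
qed

lemma Q_component: "Q \<theta> $ 1 $ 1 = cos \<theta>" "Q \<theta> $ 1 $ 2 = - sin \<theta>" "Q \<theta> $ 2 $ 1 = sin \<theta>" "Q \<theta> $ 2 $ 2 = cos \<theta>"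
  by (simp_all add: Q_def)

lemma orthogonal_Q: "orthogonal_matrix (Q \<theta>)"
  unfolding orthogonal_matrix
  by (simp add: vec_eq_iff forall_2 matrix_matrix_mult_def transpose_def sum_2 Q_component mat_def
      flip: power2_eq_square)

lemma transpose_Q: "transpose (Q \<theta>) = Q (- \<theta>)"
  by (simp add: vec_eq_iff forall_2 transpose_def Q_component)

text \<open>
  Curl and divergence are invariant under rotations, whereas the two shears are the components of
  the trace-free symmetric part of the derivative, which turns by the double angle.
\<close>
definition nabla_rotation :: "real \<Rightarrow> real^4^4" where
  "nabla_rotation \<theta> = (\<chi> i j.
     if i = 3 \<and> j = 3 \<or> i = 4 \<and> j = 4 then cos (2 * \<theta>)
     else if i = 3 \<and> j = 4 then - sin (2 * \<theta>)
     else if i = 4 \<and> j = 3 then sin (2 * \<theta>)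
     else if i = j then 1 else 0)"

lemma orthogonal_nabla_rotation: "orthogonal_matrix (nabla_rotation \<theta>)"
  unfolding orthogonal_matrix
  by (simp add: vec_eq_iff forall_4 matrix_matrix_mult_def transpose_def sum_4 nabla_rotation_def mat_def
      flip: power2_eq_square)

text \<open>
  The derivatives \<open>m l k\<close> of the components of \<open>w\<close> transform as a matrix by conjugation with the
  rotation; expanding the four combinations gives the double-angle matrix. It only mixes the third
  and fourth entries, so it commutes with \<open>diag b\<close> because these weights agree.
\<close>
lemma nabla_N_pull:
  assumes w: "w \<in> vector_measures \<Omega>" and b: "b $ 3 = b $ 4"
    and \<phi>: "\<phi> \<in> test_funs (matrix_preimage (Q \<theta>) \<Omega>)"
  shows "(mat_distr (diag b) (nabla_N (distr_of_measure (matrix_preimage (Q \<theta>) \<Omega>)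
            (pull_measure (Q \<theta>) (transpose (Q \<theta>)) w))) $ i) \<phi>
       = (\<Sum>j\<in>UNIV. nabla_rotation \<theta> $ i $ j *
            (mat_distr (diag b) (nabla_N (distr_of_measure \<Omega> w)) $ j) (\<lambda>x. \<phi> (transpose (Q \<theta>) *v x)))"
proof -
  let ?U = "Q \<theta>" and ?V = "matrix_preimage (Q \<theta>) \<Omega>"
  let ?W' = "distr_of_measure ?V (pull_measure ?U (transpose ?U) w)" and ?W = "distr_of_measure \<Omega> w"
  define m where "m l k = D l (?W $ k) (\<lambda>x. \<phi> (transpose ?U *v x))" for l k
  have diag: "(mat_distr (diag b) T $ i) \<psi> = b $ i * (T $ i) \<psi>" for T :: "distr^4" and i \<psi>
    using exhaust_4[of i] by (auto simp: mat_distr_def diag_def sum_4)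
  have D: "D j (?W' $ i) \<phi> = (\<Sum>k\<in>UNIV. ?U $ k $ i * (\<Sum>l\<in>UNIV. ?U $ l $ j * m l k))" for i j
  proof -
    have "D j (?W' $ i) \<phi>
        = (\<Sum>k\<in>UNIV. ?U $ k $ i * (- (?W $ k) (\<lambda>x. partial j \<phi> (transpose ?U *v x))))"
      using signed_integral_pull_measure[OF orthogonal_Q w test_funs_bounded_borel[OF test_funs_partial[OF \<phi>]]]
      by (simp add: D_def distr_of_measure_def transpose_def sum_negf)
    then show ?thesis
      by (simp add: D_compose[OF orthogonal_Q \<phi> linear_distr_of_measure[OF w]] m_def)
  qed
  have one: "cos \<theta> * cos \<theta> + sin \<theta> * sin \<theta> = 1"
    using sin_cos_squared_add2[of \<theta>] by (simp add: power2_eq_square)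
  have double: "cos (2 * \<theta>) = cos \<theta> * cos \<theta> - sin \<theta> * sin \<theta>"
    "sin (2 * \<theta>) = 2 * sin \<theta> * cos \<theta>"
    by (simp_all add: cos_double sin_double power2_eq_square)
  note expand = D sum_2 Q_component double
  have curl: "D 1 (?W' $ 2) \<phi> - D 2 (?W' $ 1) \<phi> = m 1 2 - m 2 1"
    unfolding expand using one by algebra
  have dvg: "D 1 (?W' $ 1) \<phi> + D 2 (?W' $ 2) \<phi> = m 1 1 + m 2 2"
    unfolding expand using one by algebra
  have sh1: "D 2 (?W' $ 2) \<phi> - D 1 (?W' $ 1) \<phi>
      = cos (2 * \<theta>) * (m 2 2 - m 1 1) - sin (2 * \<theta>) * (m 2 1 + m 1 2)"
    unfolding expand by algebra
  have sh2: "D 2 (?W' $ 1) \<phi> + D 1 (?W' $ 2) \<phi>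
      = sin (2 * \<theta>) * (m 2 2 - m 1 1) + cos (2 * \<theta>) * (m 2 1 + m 1 2)"
    unfolding expand by algebra
  show ?thesis
    using exhaust_4[of i]
    by (auto simp: diag nabla_N_def sum_4 nabla_rotation_def curl_def dvg_def sh1_def sh2_def
        m_def[symmetric] curl dvg sh1 sh2 b)
       (simp_all add: algebra_simps)
qed

lemma grad_pull:
  assumes U: "orthogonal_matrix U" and w: "w \<in> vector_measures \<Omega>"
    and u: "integrable (lebesgue_on \<Omega>) u"
    and u': "\<And>\<phi>. \<phi> \<in> test_funs (matrix_preimage U \<Omega>) \<Longrightarrow>
        distr_of_fun (matrix_preimage U \<Omega>) u' \<phi> = distr_of_fun \<Omega> u (\<lambda>x. \<phi> (transpose U *v x))"
    and \<phi>: "\<phi> \<in> test_funs (matrix_preimage U \<Omega>)"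
  shows "(minus_distr (grad (distr_of_fun (matrix_preimage U \<Omega>) u'))
            (distr_of_measure (matrix_preimage U \<Omega>) (pull_measure U (transpose U) w)) $ i) \<phi>
       = (\<Sum>j\<in>UNIV. transpose U $ i $ j *
            (minus_distr (grad (distr_of_fun \<Omega> u)) (distr_of_measure \<Omega> w) $ j) (\<lambda>x. \<phi> (transpose U *v x)))"
proof -
  let ?V = "matrix_preimage U \<Omega>"
  have "D i (distr_of_fun ?V u') \<phi>
      = (\<Sum>l\<in>UNIV. U $ l $ i * D l (distr_of_fun \<Omega> u) (\<lambda>x. \<phi> (transpose U *v x)))"
    using D_compose[OF U \<phi> linear_distr_of_fun[OF u]] by (simp add: D_def u'[OF test_funs_partial[OF \<phi>]])
  then show ?thesis
    using signed_integral_pull_measure[OF U w test_funs_bounded_borel[OF \<phi>]]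
    by (simp add: minus_distr_def grad_def distr_of_measure_def transpose_def right_diff_distrib sum_subtractf)
qed

text \<open>
  Every competitor \<open>w\<close> on \<open>\<Omega>\<close> is turned into a competitor on the rotated domain whose two
  contributions are not larger.
  The relation between \<open>u\<close> and \<open>u'\<close> is stated for the distributions that they define, because in
  this form it can be inverted without returning to almost-everywhere statements.
\<close>
lemma R_matrix_preimage_le:
  fixes b :: "real^4"
  assumes u: "integrable (lebesgue_on \<Omega>) u" and b: "b $ 3 = b $ 4"
    and u': "\<And>\<phi>. \<phi> \<in> test_funs (matrix_preimage (Q \<theta>) \<Omega>) \<Longrightarrow>
        distr_of_fun (matrix_preimage (Q \<theta>) \<Omega>) u' \<phi> = distr_of_fun \<Omega> u (\<lambda>x. \<phi> (transpose (Q \<theta>) *v x))"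
  shows "R (matrix_preimage (Q \<theta>) \<Omega>) b u' \<le> R \<Omega> b u"
  unfolding R_def[of \<Omega>]
proof (rule INF_greatest)
  let ?U = "Q \<theta>" and ?V = "matrix_preimage (Q \<theta>) \<Omega>"
  fix w :: "(real^2) set \<Rightarrow> real^2" assume w: "w \<in> vector_measures \<Omega>"
  let ?w' = "pull_measure ?U (transpose ?U) w"
  have "?w' \<in> vector_measures ?V"
    by (rule pull_measure_vector_measures[OF orthogonal_Q w])
  then have "R ?V b u' \<le> distr_norm ?V (minus_distr (grad (distr_of_fun ?V u')) (distr_of_measure ?V ?w'))
      + distr_norm ?V (mat_distr (diag b) (nabla_N (distr_of_measure ?V ?w')))"
    unfolding R_def by (rule INF_lower)
  also have "\<dots> \<le> distr_norm \<Omega> (minus_distr (grad (distr_of_fun \<Omega> u)) (distr_of_measure \<Omega> w))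
      + distr_norm \<Omega> (mat_distr (diag b) (nabla_N (distr_of_measure \<Omega> w)))"
  proof (rule add_mono)
    show "distr_norm ?V (minus_distr (grad (distr_of_fun ?V u')) (distr_of_measure ?V ?w'))
        \<le> distr_norm \<Omega> (minus_distr (grad (distr_of_fun \<Omega> u)) (distr_of_measure \<Omega> w))"
      by (rule distr_norm_pull_le[OF orthogonal_Q _ grad_pull[OF orthogonal_Q w u u']])
        (simp add: orthogonal_Q)
    show "distr_norm ?V (mat_distr (diag b) (nabla_N (distr_of_measure ?V ?w')))
        \<le> distr_norm \<Omega> (mat_distr (diag b) (nabla_N (distr_of_measure \<Omega> w)))"
      by (rule distr_norm_pull_le[OF orthogonal_Q orthogonal_nabla_rotation nabla_N_pull[OF w b]])
  qed
  finally show "R ?V b u' \<le> distr_norm \<Omega> (minus_distr (grad (distr_of_fun \<Omega> u)) (distr_of_measure \<Omega> w))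
      + distr_norm \<Omega> (mat_distr (diag b) (nabla_N (distr_of_measure \<Omega> w)))" .
qed

theorem theorem4:
  fixes \<Omega> :: "(real^2) set" and \<beta> :: "real^4" and \<theta> :: real
    and u u' :: "real^2 \<Rightarrow> real"
  assumes "open \<Omega>" and "bounded \<Omega>" and "lipschitz_boundary \<Omega>"
    and "\<And>i. 0 \<le> \<beta> $ i" and "\<beta> $ 3 = \<beta> $ 4"
    and "0 \<le> \<theta>" and "\<theta> < 2 * pi"
    and "u \<in> BV \<Omega>"
    and "AE x in lebesgue_on (rotated_domain \<theta> \<Omega>). u' x = u (Q \<theta> *v x)"
  shows "u' \<in> BV (rotated_domain \<theta> \<Omega>) \<and>
         R (rotated_domain \<theta> \<Omega>) (\<chi> i. sqrt (\<beta> $ i)) u' = R \<Omega> (\<chi> i. sqrt (\<beta> $ i)) u"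
proof -
  let ?V = "matrix_preimage (Q \<theta>) \<Omega>" and ?b = "\<chi> i. sqrt (\<beta> $ i)"
  have V: "rotated_domain \<theta> \<Omega> = ?V"
    by (simp add: rotated_domain_def matrix_preimage_def)
  have u_BV: "integrable (lebesgue_on \<Omega>) u" "total_variation \<Omega> u < \<infinity>"
    using assms(8) by (auto simp: BV_def)
  interpret rotated_function "Q \<theta>" \<Omega> u u'
    using assms(1) assms(9)[unfolded V] u_BV(1) by unfold_locales (simp_all add: orthogonal_Q)
  have rel: "distr_of_fun ?V u' \<phi> = distr_of_fun \<Omega> u (\<lambda>x. \<phi> (transpose (Q \<theta>) *v x))"
    if "\<phi> \<in> test_funs ?V" for \<phi>
    using integral_rotated[OF test_funs_continuous_bounded(1)[OF that]] by (simp add: distr_of_fun_def)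
  \<comment> \<open>The reverse inequality is the same estimate for the inverse rotation.\<close>
  have preimage_back: "matrix_preimage (Q (- \<theta>)) ?V = \<Omega>"
    using matrix_preimage_transpose[OF orthogonal_Q] by (simp add: transpose_Q)
  have "distr_of_fun \<Omega> u \<psi> = distr_of_fun ?V u' (\<lambda>x. \<psi> (transpose (Q (- \<theta>)) *v x))"
    if \<psi>: "\<psi> \<in> test_funs \<Omega>" for \<psi>
  proof -
    have "(\<lambda>x. \<psi> (Q \<theta> *v x)) \<in> test_funs ?V"
      using test_funs_compose[OF orthogonal_Q, of \<psi> "- \<theta>" ?V] \<psi> by (simp add: preimage_back transpose_Q)
    from rel[OF this] show ?thesis
      by (simp add: transpose_Q orthogonal_matrix_cancel(1)[OF orthogonal_Q, unfolded transpose_Q])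
  qed
  then have "R (matrix_preimage (Q (- \<theta>)) ?V) ?b u \<le> R ?V ?b u'"
    by (intro R_matrix_preimage_le integrable_rotated) (simp_all add: preimage_back assms(5))
  moreover have "R ?V ?b u' \<le> R \<Omega> ?b u"
    by (rule R_matrix_preimage_le[OF u_BV(1) _ rel]) (simp add: assms(5))
  moreover have "u' \<in> BV ?V"
    using integrable_rotated order.strict_trans1[OF total_variation_rotated_le u_BV(2)] by (simp add: BV_def)
  ultimately show ?thesis
    by (simp add: V preimage_back)
qed

end
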